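(* Let $\alpha,\epsilon,\omega\in(0,1/2]$ with $\alpha\le\omega/4$. Let $g:\mathbb{F}_2^n\to\{-1,1\}$ be a known function with $t=\|g\|_{1,\alpha}$, and let $f:\mathbb{F}_2^n\to\{-1,1\}$ be an unknown function to which query access is given. Under the promise that either $\delta_{\mathcal{L}}(f,g)\le\epsilon$ or $\delta_{\mathcal{L}}(f,g)\ge\epsilon+\omega$, there is a randomized algorithm that decides which case holds with success probability at least $2/3$ and makes $\tilde{O}\left((t/\omega)^{24}\right)$ queries to $f$, where $\tilde{O}(\cdot)$ hides multiplicative factors polylogarithmic in $t$, $1/\alpha$ and $\log(1/\omega)$.
   Context: Query access to $f$ means that for any $x\in\mathbb{F}_2^n$ the algorithm may obtain $f(x)$ at unit cost; query complexity is the number of such evaluations. For $S\in\mathbb{F}_2^n$, $\chi_S(x)=(-1)^{\langle S,x\rangle}$, and every $p:\mathbb{F}_2^n\to\mathbb{R}$ has a unique expansion $p=\sum_{S}\widehat p(S)\chi_S$; $\|p\|_1=\sum_S|\widehat p(S)|$. A function $p:\mathbb{F}_2^n\to\mathbb{R}$ $\alpha$-approximates $g$ if $|g(x)-p(x)|\le\alpha$ for all $x$, and $\|g\|_{1,\alpha}=\inf\{\|p\|_1: p\ \alpha\text{-approximates } g\}$. $\delta(f,g)=\Pr_x[f(x)\ne g(x)]$ for uniform $x$; $(f\circ M)(x)=f(Mx)$ for $M\in GL_n(\mathbb{F}_2)$; $\delta_{\mathcal{L}}(f,g)=\min_{M\in GL_n(\mathbb{F}_2)}\delta(f\circ M,g)$.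 *)

theory Defs
  imports
    "HOL-Probability.Probability_Mass_Function"
    "HOL-Library.Z2"
    "Jordan_Normal_Form.Matrix"
begin

text \<open>
  The space \<open>F_2^n\<close> is \<^term>\<open>carrier_vec n :: bit Matrix.vec set\<close>; the dimension has to be a term
  because the constants hidden in the query bound must not depend on it.  Functions on \<open>F_2^n\<close> are
  total functions on \<^typ>\<open>bit Matrix.vec\<close> of which only the values on the carrier are ever used.
\<close>

type_synonym bvec = "bit Matrix.vec"

instance bit :: finite
proof
  have "(UNIV :: bit set) = {0, 1}"
    using bit_not_one_iff by blast
  then show "finite (UNIV :: bit set)"
    by (metis finite.emptyI finite_insert)
qed

lemma card_UNIV_bit: "card (UNIV :: bit set) = 2"
proof -
  have "(UNIV :: bit set) = {0, 1}"
    using bit_not_one_iff by blast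
  then have "card (UNIV :: bit set) = card {0, 1 :: bit}"
    by (rule arg_cong)
  also have "\<dots> = 2"
    by (subst card_2_iff) auto
  finally show ?thesis .
qed

definition chi :: "bvec \<Rightarrow> bvec \<Rightarrow> real" where
  "chi S x = (if scalar_prod S x = 0 then 1 else - 1)"

text \<open>
  The coefficients of the expansion of \<open>p\<close> in the characters, given by the inversion formula; see
  \<open>fourier_expansion\<close> and \<open>fourier_coeff_unique\<close> below.
\<close>

definition fourier_coeff :: "nat \<Rightarrow> (bvec \<Rightarrow> real) \<Rightarrow> bvec \<Rightarrow> real" where
  "fourier_coeff n p S = (\<Sum>x\<in>carrier_vec n. p x * chi S x) / 2 ^ n"

definition spectral_norm :: "nat \<Rightarrow> (bvec \<Rightarrow> real) \<Rightarrow> real" where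
  "spectral_norm n p = (\<Sum>S\<in>carrier_vec n. \<bar>fourier_coeff n p S\<bar>)"

definition approximates :: "nat \<Rightarrow> real \<Rightarrow> (bvec \<Rightarrow> real) \<Rightarrow> (bvec \<Rightarrow> real) \<Rightarrow> bool" where
  "approximates n \<alpha> p g \<longleftrightarrow> (\<forall>x\<in>carrier_vec n. \<bar>g x - p x\<bar> \<le> \<alpha>)"

definition approx_spectral_norm :: "nat \<Rightarrow> real \<Rightarrow> (bvec \<Rightarrow> real) \<Rightarrow> real" where
  "approx_spectral_norm n \<alpha> g = Inf {spectral_norm n p | p. approximates n \<alpha> p g}"

definition GL :: "nat \<Rightarrow> bit Matrix.mat set" where
  "GL n = {M \<in> carrier_mat n n. invertible_mat M}"

definition rel_dist :: "nat \<Rightarrow> (bvec \<Rightarrow> real) \<Rightarrow> (bvec \<Rightarrow> real) \<Rightarrow> real" where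
  "rel_dist n f g = measure_pmf.prob (pmf_of_set (carrier_vec n)) {x. f x \<noteq> g x}"

definition lin_dist :: "nat \<Rightarrow> (bvec \<Rightarrow> real) \<Rightarrow> (bvec \<Rightarrow> real) \<Rightarrow> real" where
  "lin_dist n f g = Min ((\<lambda>M. rel_dist n (\<lambda>x. f (mult_mat_vec M x)) g) ` GL n)"

text \<open>
  A deterministic query algorithm for an unknown function with values in \<open>{-1, 1}\<close> is a decision
  tree: \<open>Query x T U\<close> evaluates the function at \<open>x\<close> and continues with \<open>T\<close> on the value \<open>-1\<close> and
  with \<open>U\<close> on the value \<open>1\<close>.  A randomized query algorithm is a probability
  distribution over such trees.
\<close>

datatype decision_tree =
    Answer bool
  | Query bvec decision_tree decision_tree

primrec outcome :: "decision_tree \<Rightarrow> (bvec \<Rightarrow> real) \<Rightarrow> bool" where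
  "outcome (Answer b) f = b"
| "outcome (Query x T U) f = (if f x = - 1 then outcome T f else outcome U f)"

primrec num_queries :: "decision_tree \<Rightarrow> (bvec \<Rightarrow> real) \<Rightarrow> nat" where
  "num_queries (Answer b) f = 0"
| "num_queries (Query x T U) f =
     Suc (if f x = - 1 then num_queries T f else num_queries U f)"

primrec query_points :: "decision_tree \<Rightarrow> bvec set" where
  "query_points (Answer b) = {}"
| "query_points (Query x T U) = insert x (query_points T \<union> query_points U)"

definition randomized_alg :: "nat \<Rightarrow> decision_tree pmf \<Rightarrow> bool" where
  "randomized_alg n A \<longleftrightarrow> (\<forall>T\<in>set_pmf A. query_points T \<subseteq> carrier_vec n)"

definition makes_queries :: "nat \<Rightarrow> decision_tree pmf \<Rightarrow> real \<Rightarrow> bool" where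
  "makes_queries n A q \<longleftrightarrow>
     (\<forall>T\<in>set_pmf A. \<forall>f\<in>carrier_vec n \<rightarrow> {- 1, 1}. real (num_queries T f) \<le> q)"

definition prob_output :: "decision_tree pmf \<Rightarrow> (bvec \<Rightarrow> real) \<Rightarrow> bool \<Rightarrow> real" where
  "prob_output A f b = measure_pmf.prob A {T. outcome T f = b}"

text \<open>
  A polylogarithmic factor of degree \<open>c\<close>, shifted so that it is well defined and at least \<open>1\<close> for
  all \<open>x \<ge> 0\<close>.
\<close>

definition polylog :: "nat \<Rightarrow> real \<Rightarrow> real" where
  "polylog c x = (1 + ln (1 + x)) ^ c"

lemma finite_carrier_vec_bit: "finite (carrier_vec n :: bvec set)"
  and card_carrier_vec_bit: "card (carrier_vec n :: bvec set) = 2 ^ n"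
proof -
  have bij: "bij_betw (\<lambda>h. Matrix.vec n h) ({..<n} \<rightarrow>\<^sub>E (UNIV :: bit set)) (carrier_vec n)"
    by (rule bij_betwI[where g = "\<lambda>v. restrict (\<lambda>i. vec_index v i) {..<n}"])
       (auto simp: restrict_def PiE_def extensional_def fun_eq_iff)
  have "finite ({..<n} \<rightarrow>\<^sub>E (UNIV :: bit set))"
    by (auto intro: finite_PiE)
  then show "finite (carrier_vec n :: bvec set)"
    using bij bij_betw_finite by blast
  show "card (carrier_vec n :: bvec set) = 2 ^ n"
    using bij_betw_same_card[OF bij] by (simp add: card_PiE card_UNIV_bit)
qed

lemma finite_GL: "finite (GL n)"
proof -
  have "GL n \<subseteq> Matrix.mat n n ` (({..<n} \<times> {..<n}) \<rightarrow>\<^sub>E UNIV)"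
  proof
    fix M assume "M \<in> GL n"
    then have M: "M = Matrix.mat n n (restrict (index_mat M) ({..<n} \<times> {..<n}))"
      by (auto simp: GL_def intro!: eq_matI)
    show "M \<in> Matrix.mat n n ` (({..<n} \<times> {..<n}) \<rightarrow>\<^sub>E UNIV)"
      by (subst M, rule imageI) (auto split: if_splits)
  qed
  then show ?thesis
    by (rule finite_subset) (auto intro!: finite_imageI finite_PiE)
qed

lemma one_in_GL: "1\<^sub>m n \<in> GL n"
  by (auto simp: GL_def invertible_mat_def inverts_mat_def intro!: exI[of _ "1\<^sub>m n"])

lemma chi_add:
  assumes "S \<in> carrier_vec n" "x \<in> carrier_vec n" "y \<in> carrier_vec n"
  shows "chi S (x + y) = chi S x * chi S y"
  using assms bit_not_one_iff
  by (auto simp: chi_def scalar_prod_add_distrib[of S n x y])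

lemma chi_commute:
  assumes "S \<in> carrier_vec n" "x \<in> carrier_vec n"
  shows "chi S x = chi x S"
  using assms by (simp add: chi_def comm_scalar_prod[of S n x])

lemma chi_zero: "S \<in> carrier_vec n \<Longrightarrow> chi S (0\<^sub>v n) = 1"
  by (simp add: chi_def)

lemma sum_chi:
  assumes x: "x \<in> carrier_vec n"
  shows "(\<Sum>S\<in>carrier_vec n. chi S x) = (if x = 0\<^sub>v n then 2 ^ n else 0)"
proof (cases "x = 0\<^sub>v n")
  case True
  then show ?thesis by (simp add: chi_zero card_carrier_vec_bit)
next
  case False
  then obtain i where i: "i < n" "vec_index x i \<noteq> 0"
    using x by (metis carrier_vecD eq_vecI index_zero_vec(1) index_zero_vec(2))
  let ?e = "unit_vec n i :: bvec"
  have e: "chi ?e x = - 1"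
    using i x by (simp add: chi_def)
  have "bij_betw (\<lambda>S. S + ?e) (carrier_vec n) (carrier_vec n)"
    by (rule bij_betwI[where g = "\<lambda>S. S + ?e"]) (auto intro!: eq_vecI simp: add.assoc)
  then have "(\<Sum>S\<in>carrier_vec n. chi S x) = (\<Sum>S\<in>carrier_vec n. chi (S + ?e) x)"
    by (rule sum.reindex_bij_betw[symmetric])
  also have "\<dots> = (\<Sum>S\<in>carrier_vec n. chi S x * chi ?e x)"
  proof (rule sum.cong)
    fix S :: bvec assume S: "S \<in> carrier_vec n"
    have "chi (S + ?e) x = chi x (S + ?e)"
      using S x by (intro chi_commute[of _ n]) auto
    also have "\<dots> = chi S x * chi ?e x"
      using S x by (subst chi_add[of _ n]) (auto simp: chi_commute[of x n])
    finally show "chi (S + ?e) x = chi S x * chi ?e x" .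
  qed simp
  also have "\<dots> = - (\<Sum>S\<in>carrier_vec n. chi S x)"
    by (simp add: e sum_negf)
  finally show ?thesis using False by simp
qed

lemma add_eq_zero_bvec:
  assumes "x \<in> carrier_vec n" "y \<in> carrier_vec n"
  shows "x + y = 0\<^sub>v n \<longleftrightarrow> x = (y :: bvec)"
proof -
  have "a + b = 0 \<longleftrightarrow> a = b" for a b :: bit
    by (cases a; cases b) auto
  then show ?thesis
    using assms by (auto simp: vec_eq_iff)
qed

lemma sum_chi_mult:
  assumes "x \<in> carrier_vec n" "y \<in> carrier_vec n"
  shows "(\<Sum>S\<in>carrier_vec n. chi S x * chi S y) = (if x = y then 2 ^ n else 0)"
proof -
  have "(\<Sum>S\<in>carrier_vec n. chi S x * chi S y) = (\<Sum>S\<in>carrier_vec n. chi S (x + y))"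
    using assms by (intro sum.cong) (simp_all add: chi_add)
  also have "\<dots> = (if x + y = 0\<^sub>v n then 2 ^ n else 0)"
    using assms by (intro sum_chi) auto
  also have "\<dots> = (if x = y then 2 ^ n else 0)"
    using assms by (simp add: add_eq_zero_bvec)
  finally show ?thesis .
qed

lemma fourier_expansion:
  assumes x: "x \<in> carrier_vec n"
  shows "p x = (\<Sum>S\<in>carrier_vec n. fourier_coeff n p S * chi S x)"
proof -
  have "(\<Sum>S\<in>carrier_vec n. fourier_coeff n p S * chi S x)
      = (\<Sum>S\<in>carrier_vec n. \<Sum>y\<in>carrier_vec n. p y * (chi S y * chi S x) / 2 ^ n)"
    by (simp add: fourier_coeff_def sum_distrib_right sum_divide_distrib mult.assoc)
  also have "\<dots> = (\<Sum>y\<in>carrier_vec n. p y * (\<Sum>S\<in>carrier_vec n. chi S y * chi S x) / 2 ^ n)"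
    by (subst sum.swap) (simp add: sum_distrib_left sum_divide_distrib)
  also have "\<dots> = (\<Sum>y\<in>carrier_vec n. if y = x then p y else 0)"
    using x by (intro sum.cong) (simp_all add: sum_chi_mult)
  also have "\<dots> = p x"
    using x by (simp add: finite_carrier_vec_bit)
  finally show ?thesis by simp
qed

lemma fourier_coeff_unique:
  assumes c: "\<And>x. x \<in> carrier_vec n \<Longrightarrow> p x = (\<Sum>S\<in>carrier_vec n. c S * chi S x)"
    and S: "S \<in> carrier_vec n"
  shows "c S = fourier_coeff n p S"
proof -
  have "(\<Sum>x\<in>carrier_vec n. p x * chi S x)
      = (\<Sum>x\<in>carrier_vec n. \<Sum>R\<in>carrier_vec n. c R * (chi x R * chi x S))"
    using S by (intro sum.cong)
      (simp_all add: c sum_distrib_right mult.assoc chi_commute[of _ n])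
  also have "\<dots> = (\<Sum>R\<in>carrier_vec n. c R * (\<Sum>x\<in>carrier_vec n. chi x R * chi x S))"
    by (subst sum.swap) (simp add: sum_distrib_left)
  also have "\<dots> = (\<Sum>R\<in>carrier_vec n. if R = S then c R * 2 ^ n else 0)"
    using S by (intro sum.cong) (simp_all add: sum_chi_mult)
  also have "\<dots> = c S * 2 ^ n"
    using S by (simp add: finite_carrier_vec_bit)
  finally show ?thesis by (simp add: fourier_coeff_def)
qed

lemma approx_spectral_norm_set:
  assumes "0 \<le> \<alpha>"
  shows "{spectral_norm n p | p. approximates n \<alpha> p g} \<noteq> {}"
    and "bdd_below {spectral_norm n p | p. approximates n \<alpha> p g}"
proof -
  have "approximates n \<alpha> g g"
    using assms by (simp add: approximates_def)
  then show "{spectral_norm n p | p. approximates n \<alpha> p g} \<noteq> {}"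
    by blast
  show "bdd_below {spectral_norm n p | p. approximates n \<alpha> p g}"
    by (rule bdd_belowI[of _ 0]) (auto simp: spectral_norm_def intro: sum_nonneg)
qed

end

theory Submission
  imports Defs
begin

text \<open>
  Let \<open>p\<close> approximate \<open>g\<close> with spectral norm at most \<open>T = 2 t\<close>.  Up to \<open>\<alpha>\<close>, the correlation of \<open>f \<circ> M\<close>
  with \<open>g\<close> is the sum over \<open>S\<close> of the products of the coefficient of \<open>p\<close> at \<open>S\<close> and that of \<open>f\<close> at
  \<open>\<phi> S\<close>, where \<open>\<phi>\<close> is the inverse transpose of \<open>M\<close>.  By Cauchy-Schwarz and Parseval only a set \<open>P\<close> of
  \<open>O(T^2 / \<omega>^2)\<close> characters of \<open>p\<close> matters, and coefficients of \<open>f\<close> of size \<open>O(\<omega> / T)\<close> are negligible.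

  Compose \<open>f\<close> with a random \<open>n \<times> k\<close> matrix \<open>B\<close>, where \<open>k = O((T / \<omega>)^4)\<close> exceeds the dimension of the
  relevant spans.  The transpose of \<open>B\<close> is injective on the span of the heavy characters of \<open>f\<close>, second
  moments show that their coefficients are preserved, and fourth moments exclude further heavy
  coefficients of \<open>f \<circ> B\<close>.  All coefficients of \<open>f \<circ> B\<close> are estimated at once from \<open>O(k T^2 / \<omega>^2)\<close>
  samples by a Chernoff bound.  The tester searches for a \<open>\<phi>\<close>, not collapsing the span of \<open>P\<close> under
  the transpose of \<open>B\<close>, for which the estimated correlation is large.  For soundness, such a \<open>\<phi>\<close> is
  changed modulo the kernel of the transpose so that the relevant images land in the span of the
  heavy characters of \<open>f\<close>, where the estimates are correct.  This makes \<open>O((t / \<omega>)^6)\<close> queries.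
\<close>

subsection \<open>Averages and Fourier coefficients\<close>

abbreviation (input) V :: "nat \<Rightarrow> bvec set" where
  "V n \<equiv> carrier_vec n"

definition avg :: "'a set \<Rightarrow> ('a \<Rightarrow> real) \<Rightarrow> real" where
  "avg A h = (\<Sum>x\<in>A. h x) / real (card A)"

lemma avg_cong: "A = B \<Longrightarrow> (\<And>x. x \<in> B \<Longrightarrow> h x = h' x) \<Longrightarrow> avg A h = avg B h'"
  by (simp add: avg_def)

lemma avg_mono: "(\<And>x. x \<in> A \<Longrightarrow> h x \<le> h' x) \<Longrightarrow> avg A h \<le> avg A h'"
  by (simp add: avg_def divide_right_mono sum_mono)

lemma avg_nonneg: "(\<And>x. x \<in> A \<Longrightarrow> 0 \<le> h x) \<Longrightarrow> 0 \<le> avg A h"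
  by (simp add: avg_def sum_nonneg)

lemma avg_add: "avg A (\<lambda>x. h x + h' x) = avg A h + avg A h'"
  by (simp add: avg_def sum.distrib add_divide_distrib)

lemma avg_diff: "avg A (\<lambda>x. h x - h' x) = avg A h - avg A h'"
  by (simp add: avg_def sum_subtractf diff_divide_distrib)

lemma avg_minus: "avg A (\<lambda>x. - h x) = - avg A h"
  by (simp add: avg_def sum_negf)

lemma avg_cmult: "avg A (\<lambda>x. c * h x) = c * avg A h"
  by (simp add: avg_def sum_distrib_left)

lemma avg_multc: "avg A (\<lambda>x. h x * c) = avg A h * c"
  by (simp add: avg_def sum_distrib_right)

lemma avg_divide: "avg A (\<lambda>x. h x / c) = avg A h / c"
  by (simp add: avg_def sum_divide_distrib mult.commute)

lemma avg_const: "finite A \<Longrightarrow> A \<noteq> {} \<Longrightarrow> avg A (\<lambda>_. c) = c"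
  by (simp add: avg_def)

lemma avg_sum: "avg A (\<lambda>x. \<Sum>i\<in>I. h i x) = (\<Sum>i\<in>I. avg A (h i))"
  unfolding avg_def by (subst sum.swap) (simp add: sum_divide_distrib)

lemma avg_swap: "avg A (\<lambda>x. avg B (h x)) = avg B (\<lambda>y. avg A (\<lambda>x. h x y))"
  unfolding avg_def sum_divide_distrib[symmetric]
  by (subst sum.swap) (simp add: mult.commute)

lemma avg_swap3:
  "avg A (\<lambda>x. avg B (\<lambda>y. avg C (\<lambda>z. avg D (h x y z))))
     = avg B (\<lambda>y. avg C (\<lambda>z. avg D (\<lambda>w. avg A (\<lambda>x. h x y z w))))"
  by (subst avg_swap, subst (2) avg_swap, subst (3) avg_swap) (rule refl)

lemma abs_avg_le: "\<bar>avg A h\<bar> \<le> avg A (\<lambda>x. \<bar>h x\<bar>)"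
  by (simp add: avg_def divide_right_mono sum_abs)

lemma avg_le_const:
  assumes "finite A" "A \<noteq> {}" "\<And>x. x \<in> A \<Longrightarrow> h x \<le> c"
  shows "avg A h \<le> c"
  using avg_mono[of A h "\<lambda>_. c"] assms by (simp add: avg_const)

lemma abs_avg_le_const:
  assumes "finite A" "A \<noteq> {}" "\<And>x. x \<in> A \<Longrightarrow> \<bar>h x\<bar> \<le> c"
  shows "\<bar>avg A h\<bar> \<le> c"
  using abs_avg_le[of A h] avg_le_const[OF assms(1,2), of "\<lambda>x. \<bar>h x\<bar>" c] assms(3)
  by fastforce

lemma avg_reindex: "bij_betw \<pi> A A \<Longrightarrow> avg A (\<lambda>x. h (\<pi> x)) = avg A h"
  by (simp add: avg_def sum.reindex_bij_betw)

lemma avg_Times: "avg (A \<times> B) h = avg A (\<lambda>x. avg B (\<lambda>y. h (x, y)))"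
  by (simp add: avg_def sum.cartesian_product sum_divide_distrib[symmetric] card_cartesian_product mult.commute)

lemma finite_V: "finite (V n)" and V_nonempty: "V n \<noteq> {}" and card_V: "card (V n) = 2 ^ n"
  using zero_carrier_vec[of n] by (blast intro: finite_carrier_vec_bit card_carrier_vec_bit)+

lemmas avg_const_V = avg_const[OF finite_V V_nonempty]
lemmas avg_le_V = avg_le_const[OF finite_V V_nonempty]
lemmas abs_avg_le_V = abs_avg_le_const[OF finite_V V_nonempty]

lemma avg_mem_le:
  assumes "finite X"
  shows "avg (V k) (\<lambda>x. of_bool (x \<in> X)) \<le> card X / 2 ^ k"
proof -
  have "(\<Sum>x\<in>V k. of_bool (x \<in> X)) = real (card (V k \<inter> X))"
    by (simp add: finite_V)
  also have "\<dots> \<le> card X"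
    using assms by (simp add: card_mono)
  finally show ?thesis
    by (simp add: avg_def card_V divide_right_mono)
qed

lemma bvec_add_self: "x \<in> V n \<Longrightarrow> x + x = 0\<^sub>v n"
  using add_eq_zero_bvec by blast

lemma bvec_add_cancel_left: "x \<in> V n \<Longrightarrow> y \<in> V n \<Longrightarrow> x + (x + y) = y"
  by (metis assoc_add_vec bvec_add_self left_zero_vec)

lemma bvec_add_cancel_right: "x \<in> V n \<Longrightarrow> y \<in> V n \<Longrightarrow> (y + x) + x = y"
  by (metis assoc_add_vec bvec_add_self right_zero_vec)

lemma bij_translate_left: "a \<in> V n \<Longrightarrow> bij_betw (\<lambda>x. a + x) (V n) (V n)"
  by (rule bij_betwI[where g = "\<lambda>x. a + x"]) (auto simp: bvec_add_cancel_left)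

section \<open>Characters, Parseval and the fourth moment identity\<close>

lemma chi_abs [simp]: "\<bar>chi S x\<bar> = 1"
  by (simp add: chi_def)

lemma fourier_coeff_avg: "fourier_coeff n p S = avg (V n) (\<lambda>x. p x * chi S x)"
  by (simp add: fourier_coeff_def avg_def card_V)

lemma avg_chi: "x \<in> V n \<Longrightarrow> avg (V n) (\<lambda>S. chi S x) = of_bool (x = 0\<^sub>v n)"
  by (simp add: avg_def card_V sum_chi)

lemma avg_chi_right: "S \<in> V n \<Longrightarrow> avg (V n) (\<lambda>x. chi S x) = of_bool (S = 0\<^sub>v n)"
proof -
  assume S: "S \<in> V n"
  then have "avg (V n) (\<lambda>x. chi S x) = avg (V n) (\<lambda>x. chi x S)"
    by (intro avg_cong) (auto intro: chi_commute)
  with S show ?thesis by (simp add: avg_chi)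
qed

lemma parseval: "(\<Sum>S\<in>V n. (fourier_coeff n p S)\<^sup>2) = avg (V n) (\<lambda>x. (p x)\<^sup>2)"
proof -
  have "avg (V n) (\<lambda>x. (p x)\<^sup>2) = avg (V n) (\<lambda>x. \<Sum>S\<in>V n. fourier_coeff n p S * (p x * chi S x))"
  proof (rule avg_cong)
    fix x assume "x \<in> V n"
    then have "(p x)\<^sup>2 = p x * (\<Sum>S\<in>V n. fourier_coeff n p S * chi S x)"
      by (subst fourier_expansion[of x n p, symmetric]) (auto simp: power2_eq_square)
    then show "(p x)\<^sup>2 = (\<Sum>S\<in>V n. fourier_coeff n p S * (p x * chi S x))"
      by (simp add: sum_distrib_left mult_ac)
  qed simp
  also have "\<dots> = (\<Sum>S\<in>V n. (fourier_coeff n p S)\<^sup>2)"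
    by (simp add: avg_sum avg_cmult fourier_coeff_avg power2_eq_square)
  finally show ?thesis by simp
qed

text \<open>Only the factor \<open>p (x + y + z)\<close> is expanded. Its characters split over
  \<open>x\<close>, \<open>y\<close> and \<open>z\<close>, so each of the three averages contributes
  one further copy of the coefficient.\<close>

lemma fourier_fourth_moment:
  "(\<Sum>S\<in>V n. (fourier_coeff n p S) ^ 4)
     = avg (V n) (\<lambda>x. avg (V n) (\<lambda>y. avg (V n) (\<lambda>z. p x * p y * p z * p (x + y + z))))"
proof -
  have "avg (V n) (\<lambda>x. avg (V n) (\<lambda>y. avg (V n) (\<lambda>z. p x * p y * p z * p (x + y + z))))
      = avg (V n) (\<lambda>x. avg (V n) (\<lambda>y. avg (V n) (\<lambda>z.
          \<Sum>S\<in>V n. fourier_coeff n p S * ((p x * chi S x) * ((p y * chi S y) * (p z * chi S z))))))"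
  proof (intro avg_cong refl)
    fix x y z assume xyz: "x \<in> V n" "y \<in> V n" "z \<in> V n"
    then have "p (x + y + z) = (\<Sum>S\<in>V n. fourier_coeff n p S * chi S (x + y + z))"
      by (intro fourier_expansion) auto
    also have "\<dots> = (\<Sum>S\<in>V n. fourier_coeff n p S * (chi S x * chi S y * chi S z))"
      using xyz by (intro sum.cong refl) (simp add: chi_add[of _ n])
    finally have e: "p (x + y + z) = \<dots>" .
    show "p x * p y * p z * p (x + y + z) =
      (\<Sum>S\<in>V n. fourier_coeff n p S * ((p x * chi S x) * ((p y * chi S y) * (p z * chi S z))))"
      unfolding e sum_distrib_left by (simp add: mult_ac)
  qed
  also have "\<dots> = (\<Sum>S\<in>V n. fourier_coeff n p S ^ 4)"
    unfolding avg_sum avg_cmult avg_multc fourier_coeff_avg[symmetric] power4_eq_xxxx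
    by (simp only: mult.assoc)
  finally show ?thesis by simp
qed

lemma sign_abs: "f \<in> A \<rightarrow> {- 1, 1 :: real} \<Longrightarrow> x \<in> A \<Longrightarrow> \<bar>f x\<bar> = 1"
  by (drule (1) PiE) auto

lemma fourier_coeff_bound:
  assumes "f \<in> V n \<rightarrow> {- 1, 1}"
  shows "\<bar>fourier_coeff n f S\<bar> \<le> 1"
  unfolding fourier_coeff_avg using assms
  by (intro abs_avg_le_V) (simp add: abs_mult sign_abs[of f "V n"])

lemma parseval_sign:
  assumes "f \<in> V n \<rightarrow> {- 1, 1}"
  shows "(\<Sum>S\<in>V n. (fourier_coeff n f S)\<^sup>2) = 1"
proof -
  have "avg (V n) (\<lambda>x. (f x)\<^sup>2) = avg (V n) (\<lambda>_. 1)"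
    using assms by (intro avg_cong) (auto simp: power2_eq_1_iff)
  then show ?thesis by (simp add: parseval avg_const_V)
qed

subsection \<open>Random restrictions\<close>

lemma finite_carrier_mat_bit: "finite (carrier_mat n k :: bit mat set)" and carrier_mat_nonempty: "carrier_mat n k \<noteq> {}"
proof -
  have "(carrier_mat n k :: bit mat set) \<subseteq> Matrix.mat n k ` (({..<n} \<times> {..<k}) \<rightarrow>\<^sub>E UNIV)"
  proof
    fix M :: "bit mat" assume "M \<in> carrier_mat n k"
    then have M: "M = Matrix.mat n k (restrict (index_mat M) ({..<n} \<times> {..<k}))"
      by (auto intro!: eq_matI)
    show "M \<in> Matrix.mat n k ` (({..<n} \<times> {..<k}) \<rightarrow>\<^sub>E UNIV)"
      by (subst M, rule imageI) (auto split: if_splits)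
  qed
  then show "finite (carrier_mat n k :: bit mat set)"
    by (rule finite_subset) (auto intro!: finite_imageI finite_PiE)
  show "carrier_mat n k \<noteq> {}"
    using zero_carrier_mat[of n k] by blast
qed

lemmas avg_const_mat = avg_const[OF finite_carrier_mat_bit carrier_mat_nonempty]
lemmas abs_avg_le_mat = abs_avg_le_const[OF finite_carrier_mat_bit carrier_mat_nonempty]

text \<open>The rank one matrix \<open>a v^T\<close>. Adding it to \<open>B\<close> translates
  \<open>B *\<^sub>v x\<close> by \<open>a\<close> if \<open>v \<bullet> x = 1\<close> and leaves it
  alone if \<open>v \<bullet> x = 0\<close>.\<close>

definition outer :: "bvec \<Rightarrow> bvec \<Rightarrow> bit mat" where
  "outer a v = Matrix.mat (dim_vec a) (dim_vec v) (\<lambda>(i, j). a $ i * v $ j)"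

lemma outer_carrier [simp]: "a \<in> V n \<Longrightarrow> v \<in> V k \<Longrightarrow> outer a v \<in> carrier_mat n k"
  by (auto simp: outer_def)

lemma outer_mult_vec:
  assumes "a \<in> V n" "v \<in> V k" "x \<in> V k"
  shows "outer a v *\<^sub>v x = (v \<bullet> x) \<cdot>\<^sub>v a"
proof (rule eq_vecI)
  fix i assume "i < dim_vec ((v \<bullet> x) \<cdot>\<^sub>v a)"
  then have i: "i < n" using assms by simp
  have "row (outer a v) i $ j = a $ i * v $ j" if "j < k" for j
    using that assms i by (simp only: outer_def carrier_vecD index_row index_mat split_conv dim_row_mat dim_col_mat)
  then have "(outer a v *\<^sub>v x) $ i = (\<Sum>j<k. (a $ i * v $ j) * x $ j)"
    using assms i outer_carrier[OF assms(1,2)]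
    by (simp only: index_mult_mat_vec carrier_matD scalar_prod_def carrier_vecD atLeast0LessThan)
       (intro sum.cong refl, simp only: lessThan_iff)
  also have "\<dots> = (\<Sum>j<k. v $ j * x $ j) * a $ i"
    unfolding sum_distrib_right by (intro sum.cong refl) (simp only: mult_ac)
  also have "\<dots> = ((v \<bullet> x) \<cdot>\<^sub>v a) $ i"
    using assms i by (simp add: scalar_prod_def atLeast0LessThan)
  finally show "(outer a v *\<^sub>v x) $ i = ((v \<bullet> x) \<cdot>\<^sub>v a) $ i" .
qed (use assms in \<open>auto simp: outer_def\<close>)

section \<open>Values of a uniformly random matrix at fixed vectors\<close>

lemma bit_mat_add_self: "A \<in> carrier_mat n k \<Longrightarrow> A + A = 0\<^sub>m n (k :: nat)" for A :: "bit mat"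
  by (intro eq_matI) auto

lemma bij_translate_mat:
  assumes "A \<in> carrier_mat n k"
  shows "bij_betw (\<lambda>B. B + A) (carrier_mat n k) (carrier_mat n k :: bit mat set)"
  by (rule bij_betwI[where g = "\<lambda>B. B + A"])
     (use assms in \<open>auto simp: assoc_add_mat[of _ n k] bit_mat_add_self[of _ n k]\<close>)

text \<open>The product \<open>?h\<close> is nonnegative, and positive exactly at the wanted
  \<open>v\<close>. Its average over \<open>v\<close> is at least \<open>1\<close>: as
  \<open>x\<close> lies outside the span of \<open>y\<close> and \<open>z\<close>, every character
  involving \<open>x\<close> averages to zero, and the other terms are nonnegative with a
  \<open>1\<close> among them.\<close>

lemma dual_vector_exists:
  assumes "x \<in> V k" "y \<in> V k" "z \<in> V k" and "x \<noteq> 0\<^sub>v k" "x \<noteq> y" "x \<noteq> z" "x \<noteq> y + z"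
  shows "\<exists>v\<in>V k. v \<bullet> x = 1 \<and> v \<bullet> y = 0 \<and> v \<bullet> z = 0"
proof -
  let ?h = "\<lambda>v. (1 - chi v x) * ((1 + chi v y) * (1 + chi v z))"
  have "avg (V k) ?h = avg (V k) (\<lambda>v. 1 + chi v y + chi v z + chi v (y + z)
      - chi v x - chi v (x + y) - chi v (x + z) - chi v (x + (y + z)))"
    using assms by (intro avg_cong refl) (simp add: chi_add[of _ k] algebra_simps)
  also have "\<dots> = 1 + of_bool (y = 0\<^sub>v k) + of_bool (z = 0\<^sub>v k) + of_bool (y + z = 0\<^sub>v k)"
    using assms by (simp add: avg_add avg_diff avg_const_V avg_chi add_eq_zero_bvec)
  also have "\<dots> > 0"
    by simp
  finally have "\<exists>v\<in>V k. ?h v > 0"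
    using avg_le_V[of k ?h 0] by (meson linorder_not_less)
  then obtain v where "v \<in> V k" "?h v > 0" by blast
  then show ?thesis
    by (intro bexI[of _ v]) (auto simp: chi_def bit_not_zero_iff split: if_splits)
qed

text \<open>The hypotheses say that \<open>x\<close>, \<open>y\<close>, \<open>z\<close> are
  linearly independent. Rank one matrices built from dual vectors then translate the three images by
  arbitrary \<open>a\<close>, \<open>b\<close>, \<open>c\<close>, and adding them permutes the set
  of matrices.\<close>

lemma avg_generic_triple:
  assumes xyz: "x \<in> V k" "y \<in> V k" "z \<in> V k"
    and x: "x \<noteq> 0\<^sub>v k" and y: "y \<notin> {0\<^sub>v k, x}" and z: "z \<notin> {0\<^sub>v k, x, y, x + y}"
  shows "avg (carrier_mat n k) (\<lambda>B. \<Phi> (B *\<^sub>v x) (B *\<^sub>v y) (B *\<^sub>v z))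
     = avg (V n) (\<lambda>a. avg (V n) (\<lambda>b. avg (V n) (\<lambda>c. \<Phi> a b c)))"
    (is "?L = ?R")
proof -
  have *: "x \<noteq> y + z" "y \<noteq> x + z"
    using z xyz by (metis bvec_add_cancel_left insert_iff comm_add_vec)+
  obtain u where u: "u \<in> V k" "u \<bullet> x = 1" "u \<bullet> y = 0" "u \<bullet> z = 0"
    using dual_vector_exists[of x k y z] xyz x y z * by auto
  obtain v where v: "v \<in> V k" "v \<bullet> y = 1" "v \<bullet> x = 0" "v \<bullet> z = 0"
    using dual_vector_exists[of y k x z] xyz x y z * by auto
  obtain w where w: "w \<in> V k" "w \<bullet> z = 1" "w \<bullet> x = 0" "w \<bullet> y = 0"
    using dual_vector_exists[of z k x y] xyz x y z * by auto
  have shift: "?L = avg (carrier_mat n k) (\<lambda>B. \<Phi> (B *\<^sub>v x + a) (B *\<^sub>v y + b) (B *\<^sub>v z + c))"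
    if abc: "a \<in> V n" "b \<in> V n" "c \<in> V n" for a b c
  proof -
    let ?A = "outer a u + outer b v + outer c w"
    have o: "outer a u \<in> carrier_mat n k" "outer b v \<in> carrier_mat n k" "outer c w \<in> carrier_mat n k"
      using abc u v w by auto
    then have A: "?A \<in> carrier_mat n k" by simp
    have smult: "1 \<cdot>\<^sub>v r = r" "0 \<cdot>\<^sub>v r = 0\<^sub>v n" if "r \<in> V n" for r :: bvec
      using that by auto
    have eval: "(B + ?A) *\<^sub>v r = B *\<^sub>v r + ((u \<bullet> r) \<cdot>\<^sub>v a + (v \<bullet> r) \<cdot>\<^sub>v b + (w \<bullet> r) \<cdot>\<^sub>v c)"
      if "B \<in> carrier_mat n k" "r \<in> V k" for B r
      using that o A u(1) v(1) w(1) abc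
      by (simp add: add_mult_distrib_mat_vec[of _ n k] outer_mult_vec[of _ n _ k])
    have "?L = avg (carrier_mat n k) (\<lambda>B. \<Phi> ((B + ?A) *\<^sub>v x) ((B + ?A) *\<^sub>v y) ((B + ?A) *\<^sub>v z))"
      by (rule avg_reindex[OF bij_translate_mat[OF A], symmetric])
    also have "\<dots> = avg (carrier_mat n k) (\<lambda>B. \<Phi> (B *\<^sub>v x + a) (B *\<^sub>v y + b) (B *\<^sub>v z + c))"
      using abc xyz by (intro avg_cong refl) (simp add: eval u v w smult)
    finally show ?thesis .
  qed
  \<comment> \<open>The left side does not depend on the translations, so it may be averaged over
    them; after exchanging the averages, the images are uniform for each fixed
    \<open>B\<close>.\<close>
  have "?L = avg (V n) (\<lambda>a. avg (V n) (\<lambda>b. avg (V n) (\<lambda>c. ?L)))"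
    by (simp add: avg_const_V)
  also have "\<dots> = avg (V n) (\<lambda>a. avg (V n) (\<lambda>b. avg (V n) (\<lambda>c.
      avg (carrier_mat n k) (\<lambda>B. \<Phi> (B *\<^sub>v x + a) (B *\<^sub>v y + b) (B *\<^sub>v z + c)))))"
    by (intro avg_cong refl shift)
  also have "\<dots> = avg (carrier_mat n k) (\<lambda>B. avg (V n) (\<lambda>a. avg (V n) (\<lambda>b. avg (V n) (\<lambda>c.
      \<Phi> (B *\<^sub>v x + a) (B *\<^sub>v y + b) (B *\<^sub>v z + c)))))"
    by (rule avg_swap3[symmetric])
  also have "\<dots> = avg (carrier_mat n k :: bit mat set) (\<lambda>B. ?R)"
  proof (rule avg_cong[OF refl])
    fix B :: "bit mat" assume "B \<in> carrier_mat n k"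
    then have B: "B *\<^sub>v x \<in> V n" "B *\<^sub>v y \<in> V n" "B *\<^sub>v z \<in> V n"
      using xyz by auto
    show "avg (V n) (\<lambda>a. avg (V n) (\<lambda>b. avg (V n) (\<lambda>c.
        \<Phi> (B *\<^sub>v x + a) (B *\<^sub>v y + b) (B *\<^sub>v z + c)))) = ?R"
      by (simp add: avg_reindex[OF bij_translate_left[OF B(3)], of "\<lambda>c. \<Phi> _ _ c"]
        avg_reindex[OF bij_translate_left[OF B(2)], of "\<lambda>b. avg (V n) (\<lambda>c. \<Phi> _ b c)"]
        avg_reindex[OF bij_translate_left[OF B(1)], of "\<lambda>a. avg (V n) (\<lambda>b. avg (V n) (\<lambda>c. \<Phi> a b c))"])
  qed
  also have "\<dots> = ?R"
    by (simp add: avg_const_mat)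
  finally show ?thesis .
qed

text \<open>
  Linearly independent vectors are mapped to independent uniform vectors, and three random vectors
  of \<open>F_2^k\<close> are dependent with probability at most \<open>7 / 2^k\<close>.
\<close>

lemma avg_random_matrix_triple:
  assumes C: "\<And>a b c. a \<in> V n \<Longrightarrow> b \<in> V n \<Longrightarrow> c \<in> V n \<Longrightarrow> \<bar>\<Phi> a b c\<bar> \<le> C"
  shows "\<bar>avg (carrier_mat n k) (\<lambda>B. avg (V k) (\<lambda>x. avg (V k) (\<lambda>y. avg (V k) (\<lambda>z.
             \<Phi> (B *\<^sub>v x) (B *\<^sub>v y) (B *\<^sub>v z)))))
          - avg (V n) (\<lambda>a. avg (V n) (\<lambda>b. avg (V n) (\<lambda>c. \<Phi> a b c)))\<bar> \<le> 14 * C / 2 ^ k"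
proof -
  define \<mu> where "\<mu> = avg (V n) (\<lambda>a. avg (V n) (\<lambda>b. avg (V n) (\<lambda>c. \<Phi> a b c)))"
  define G where "G x y z = avg (carrier_mat n k) (\<lambda>B. \<Phi> (B *\<^sub>v x) (B *\<^sub>v y) (B *\<^sub>v z))" for x y z
  let ?bad = "\<lambda>x y z. of_bool (x \<in> {0\<^sub>v k}) + of_bool (y \<in> {0\<^sub>v k, x})
    + of_bool (z \<in> {0\<^sub>v k, x, y, x + y}) :: real"
  have "\<bar>\<mu>\<bar> \<le> C"
    unfolding \<mu>_def by (intro abs_avg_le_V C)
  then have C0: "0 \<le> C" by linarith
  \<comment> \<open>For independent vectors the deviation vanishes; otherwise it is at most
    \<open>2 * C\<close>. As the three excluded sets have at most \<open>1\<close>, \<open>2\<close>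
    and \<open>4\<close> elements, the constant becomes \<open>14 = 2 * 7\<close>.\<close>
  have dev: "\<bar>G x y z - \<mu>\<bar> \<le> 2 * C * ?bad x y z" if xyz: "x \<in> V k" "y \<in> V k" "z \<in> V k" for x y z
  proof (cases "x = 0\<^sub>v k \<or> y \<in> {0\<^sub>v k, x} \<or> z \<in> {0\<^sub>v k, x, y, x + y}")
    case True
    have "\<bar>G x y z\<bar> \<le> C"
      unfolding G_def using xyz by (intro abs_avg_le_mat C) auto
    then have "\<bar>G x y z - \<mu>\<bar> \<le> 2 * C * 1"
      using \<open>\<bar>\<mu>\<bar> \<le> C\<close> by linarith
    also have "\<dots> \<le> 2 * C * ?bad x y z"
      using True C0 by (intro mult_left_mono) auto
    finally show ?thesis .
  next
    case False
    then have "G x y z = \<mu>"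
      unfolding G_def \<mu>_def using xyz by (intro avg_generic_triple) auto
    then have "\<bar>G x y z - \<mu>\<bar> = 0" by (simp only: diff_self abs_zero)
    also have "0 \<le> 2 * C * ?bad x y z"
      using C0 by (intro mult_nonneg_nonneg add_nonneg_nonneg) simp_all
    finally show ?thesis .
  qed
  have card3: "real (card {a, b, c, d}) \<le> 4" for a b c d :: bvec
    by (simp add: card_insert_if)
  have card2: "real (card {a, b}) \<le> 2" for a b :: bvec
    by (simp add: card_insert_if)
  have "avg (V k) (\<lambda>x. avg (V k) (\<lambda>y. avg (V k) (\<lambda>z. ?bad x y z)))
    \<le> avg (V k) (\<lambda>x. avg (V k) (\<lambda>y. of_bool (x \<in> {0\<^sub>v k}) + of_bool (y \<in> {0\<^sub>v k, x}) + 4 / 2 ^ k))"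
    by (intro avg_mono, simp only: avg_add avg_const_V, intro add_left_mono
        order_trans[OF avg_mem_le] divide_right_mono card3) auto
  also have "\<dots> \<le> avg (V k) (\<lambda>x. of_bool (x \<in> {0\<^sub>v k}) + 2 / 2 ^ k + 4 / 2 ^ k)"
    by (intro avg_mono, simp only: avg_add avg_const_V, intro add_left_mono add_right_mono
        order_trans[OF avg_mem_le] divide_right_mono card2) auto
  also have "\<dots> \<le> 1 / 2 ^ k + 2 / 2 ^ k + 4 / 2 ^ k"
    by (simp only: avg_add avg_const_V, intro add_left_mono add_right_mono
        order_trans[OF avg_mem_le]) auto
  finally have bad: "avg (V k) (\<lambda>x. avg (V k) (\<lambda>y. avg (V k) (\<lambda>z. ?bad x y z))) \<le> 7 / 2 ^ k"
    by (simp add: add_divide_distrib[symmetric])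
  have "avg (carrier_mat n k) (\<lambda>B. avg (V k) (\<lambda>x. avg (V k) (\<lambda>y. avg (V k) (\<lambda>z.
             \<Phi> (B *\<^sub>v x) (B *\<^sub>v y) (B *\<^sub>v z))))) - \<mu>
      = avg (V k) (\<lambda>x. avg (V k) (\<lambda>y. avg (V k) (\<lambda>z. G x y z - \<mu>)))"
    unfolding G_def avg_diff avg_const_V by (subst avg_swap3) (rule refl)
  also have "\<bar>\<dots>\<bar> \<le> avg (V k) (\<lambda>x. avg (V k) (\<lambda>y. avg (V k) (\<lambda>z. 2 * C * ?bad x y z)))"
    by ((rule order_trans[OF abs_avg_le], rule avg_mono)+, rule dev)
  also have "\<dots> \<le> 2 * C * (7 / 2 ^ k)"
    unfolding avg_cmult using C0 by (intro mult_left_mono bad) auto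
  finally show ?thesis
    by (simp add: \<mu>_def)
qed

lemma avg_random_matrix_pair:
  assumes "\<And>a b. a \<in> V n \<Longrightarrow> b \<in> V n \<Longrightarrow> \<bar>\<Phi> a b\<bar> \<le> C"
  shows "\<bar>avg (carrier_mat n k) (\<lambda>B. avg (V k) (\<lambda>x. avg (V k) (\<lambda>y. \<Phi> (B *\<^sub>v x) (B *\<^sub>v y))))
          - avg (V n) (\<lambda>a. avg (V n) (\<lambda>b. \<Phi> a b))\<bar> \<le> 14 * C / 2 ^ k"
  using avg_random_matrix_triple[of n "\<lambda>a b c. \<Phi> a b" C k] assms by (simp add: avg_const_V)

lemma avg_random_matrix_single:
  assumes "\<And>a. a \<in> V n \<Longrightarrow> \<bar>\<Phi> a\<bar> \<le> C"
  shows "\<bar>avg (carrier_mat n k) (\<lambda>B. avg (V k) (\<lambda>x. \<Phi> (B *\<^sub>v x))) - avg (V n) \<Phi>\<bar>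
    \<le> 14 * C / 2 ^ k"
  using avg_random_matrix_pair[of n "\<lambda>a b. \<Phi> a" C k] assms by (simp add: avg_const_V)

section \<open>Fourier coefficients of a random restriction\<close>

lemma transpose_vec_carrier [simp]:
  "B \<in> carrier_mat n k \<Longrightarrow> transpose_mat B *\<^sub>v S \<in> carrier_vec k"
  by (rule carrier_vecI) simp

lemma chi_transpose:
  assumes "B \<in> carrier_mat n k" "S \<in> V n" "x \<in> V k"
  shows "chi (transpose_mat B *\<^sub>v S) x = chi S (B *\<^sub>v x)"
  using assms by (simp add: chi_def transpose_vec_mult_scalar[of B n k])

abbreviation restricted_coeff :: "nat \<Rightarrow> (bvec \<Rightarrow> real) \<Rightarrow> bit mat \<Rightarrow> bvec \<Rightarrow> real" where
  "restricted_coeff k f B \<equiv> fourier_coeff k (\<lambda>x. f (B *\<^sub>v x))"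

text \<open>Both factors become functions of \<open>B *\<^sub>v x\<close>, the form to which the
  averages over random matrices apply.\<close>

lemma restricted_coeff_transpose:
  assumes "B \<in> carrier_mat n k" "S \<in> V n"
  shows "restricted_coeff k f B (transpose_mat B *\<^sub>v S)
    = avg (V k) (\<lambda>x. f (B *\<^sub>v x) * chi S (B *\<^sub>v x))"
  unfolding fourier_coeff_avg using assms by (intro avg_cong refl) (simp add: chi_transpose)

lemma restricted_coeff_bound:
  assumes "f \<in> V n \<rightarrow> {- 1, 1}" "B \<in> carrier_mat n k"
  shows "\<bar>restricted_coeff k f B u\<bar> \<le> 1"
  using assms by (intro fourier_coeff_bound) (auto intro: PiE mult_mat_vec_carrier)

text \<open>The indicator of the kernel is an average of a character over \<open>x\<close>, hence a
  first moment in \<open>B *\<^sub>v x\<close>, and \<open>chi S\<close> has mean zero on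
  \<open>V n\<close>.\<close>

lemma prob_transpose_kernel:
  assumes S: "S \<in> V n" "S \<noteq> 0\<^sub>v n"
  shows "avg (carrier_mat n k) (\<lambda>B. of_bool (transpose_mat B *\<^sub>v S = 0\<^sub>v k)) \<le> 14 / 2 ^ k"
proof -
  have "avg (carrier_mat n k) (\<lambda>B. of_bool (transpose_mat B *\<^sub>v S = 0\<^sub>v k))
      = avg (carrier_mat n k) (\<lambda>B. avg (V k) (\<lambda>x. chi S (B *\<^sub>v x)))"
  proof (rule avg_cong[OF refl])
    fix B :: "bit mat" assume B: "B \<in> carrier_mat n k"
    have "of_bool (transpose_mat B *\<^sub>v S = 0\<^sub>v k) = avg (V k) (\<lambda>x. chi (transpose_mat B *\<^sub>v S) x)"
      using B by (simp add: avg_chi_right)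
    also have "\<dots> = avg (V k) (\<lambda>x. chi S (B *\<^sub>v x))"
      using B S by (intro avg_cong refl) (simp add: chi_transpose)
    finally show "of_bool (transpose_mat B *\<^sub>v S = 0\<^sub>v k) = \<dots>" .
  qed
  also have "\<dots> \<le> 14 / 2 ^ k"
    using avg_random_matrix_single[of n "chi S" 1 k] S by (simp add: avg_chi_right)
  finally show ?thesis .
qed

text \<open>\<open>W\<close> will be a subspace that contains the heavy characters \<open>L\<close>,
  so that the first condition makes the transpose of \<open>B\<close> injective on \<open>W\<close>.
  It is stated for \<open>W\<close> rather than \<open>L\<close> because the images of the
  characters of \<open>p\<close> have to be kept apart from \<open>L\<close> as well.\<close>

definition good_matrix :: "nat \<Rightarrow> nat \<Rightarrow> (bvec \<Rightarrow> real) \<Rightarrow> bvec set \<Rightarrow> bvec set \<Rightarrow> real \<Rightarrow> bit mat \<Rightarrow> bool" where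
  "good_matrix n k f W L \<theta> B \<longleftrightarrow>
     (\<forall>w\<in>W. transpose_mat B *\<^sub>v w = 0\<^sub>v k \<longrightarrow> w = 0\<^sub>v n) \<and>
     (\<forall>S\<in>L. \<bar>restricted_coeff k f B (transpose_mat B *\<^sub>v S) - fourier_coeff n f S\<bar> \<le> \<theta>) \<and>
     (\<forall>u\<in>V k - (\<lambda>S. transpose_mat B *\<^sub>v S) ` L. \<bar>restricted_coeff k f B u\<bar> \<le> \<theta>)"

context
  fixes n :: nat and f :: "bvec \<Rightarrow> real"
  assumes f: "f \<in> V n \<rightarrow> {- 1, 1}"
begin

lemma mean_restricted_coeff:
  assumes S: "S \<in> V n"
  shows "\<bar>avg (carrier_mat n k) (\<lambda>B. restricted_coeff k f B (transpose_mat B *\<^sub>v S))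
    - fourier_coeff n f S\<bar> \<le> 14 / 2 ^ k"
proof -
  have "avg (carrier_mat n k) (\<lambda>B. restricted_coeff k f B (transpose_mat B *\<^sub>v S))
    = avg (carrier_mat n k) (\<lambda>B. avg (V k) (\<lambda>x. f (B *\<^sub>v x) * chi S (B *\<^sub>v x)))"
    using S by (intro avg_cong refl restricted_coeff_transpose)
  then show ?thesis
    using avg_random_matrix_single[of n "\<lambda>a. f a * chi S a" 1 k] f
    by (simp add: fourier_coeff_avg abs_mult sign_abs)
qed

text \<open>After centring, the square is a pair average of \<open>h\<close>, and for independent
  uniform arguments this factors into two means of \<open>h\<close>, which are zero. The error
  constant is \<open>14\<close> times the bound \<open>4\<close> on a product of two values of
  \<open>h\<close>.\<close>

lemma variance_restricted_coeff:
  assumes S: "S \<in> V n"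
  shows "avg (carrier_mat n k) (\<lambda>B. (restricted_coeff k f B (transpose_mat B *\<^sub>v S)
    - fourier_coeff n f S)\<^sup>2) \<le> 56 / 2 ^ k"
proof -
  define h where "h a = f a * chi S a - fourier_coeff n f S" for a
  have h: "\<bar>h a\<bar> \<le> 2" if "a \<in> V n" for a
    using fourier_coeff_bound[OF f, of S] sign_abs[OF f that]
    unfolding h_def by (intro order_trans[OF abs_triangle_ineq4]) (simp add: abs_mult)
  have mean: "avg (V n) h = 0"
    by (simp add: h_def[abs_def] avg_diff avg_const_V fourier_coeff_avg)
  have "avg (carrier_mat n k) (\<lambda>B. (restricted_coeff k f B (transpose_mat B *\<^sub>v S)
      - fourier_coeff n f S)\<^sup>2)
    = avg (carrier_mat n k) (\<lambda>B. avg (V k) (\<lambda>x. avg (V k) (\<lambda>y. h (B *\<^sub>v x) * h (B *\<^sub>v y))))"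
  proof (rule avg_cong[OF refl])
    fix B :: "bit mat" assume B: "B \<in> carrier_mat n k"
    have "restricted_coeff k f B (transpose_mat B *\<^sub>v S) - fourier_coeff n f S = avg (V k) (\<lambda>x. h (B *\<^sub>v x))"
      using B S by (simp add: restricted_coeff_transpose h_def avg_diff avg_const_V)
    then show "(restricted_coeff k f B (transpose_mat B *\<^sub>v S) - fourier_coeff n f S)\<^sup>2
      = avg (V k) (\<lambda>x. avg (V k) (\<lambda>y. h (B *\<^sub>v x) * h (B *\<^sub>v y)))"
      by (simp only: avg_cmult avg_multc power2_eq_square)
  qed
  also have "\<dots> \<le> avg (V n) (\<lambda>a. avg (V n) (\<lambda>b. h a * h b)) + 14 * 4 / 2 ^ k"
  proof -
    have "\<bar>h a * h b\<bar> \<le> 4" if "a \<in> V n" "b \<in> V n" for a b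
      using mult_mono[OF h h, OF that] by (simp add: abs_mult)
    from avg_random_matrix_pair[of n "\<lambda>a b. h a * h b" 4 k, OF this]
    show ?thesis by linarith
  qed
  also have "\<dots> = 56 / 2 ^ k"
    by (simp add: avg_cmult mean avg_const_V)
  finally show ?thesis .
qed

text \<open>By linearity of \<open>B\<close> the fourth moment of the restriction is an average over
  the images of three random vectors, so it is close to the same average over independent uniform
  vectors.\<close>

lemma fourth_moment_restricted_coeff:
  "avg (carrier_mat n k) (\<lambda>B. \<Sum>u\<in>V k. restricted_coeff k f B u ^ 4)
    \<le> (\<Sum>S\<in>V n. fourier_coeff n f S ^ 4) + 14 / 2 ^ k"
proof -
  let ?\<Phi> = "\<lambda>a b c. f a * f b * f c * f (a + b + c)"
  have "avg (carrier_mat n k) (\<lambda>B. \<Sum>u\<in>V k. restricted_coeff k f B u ^ 4)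
    = avg (carrier_mat n k) (\<lambda>B. avg (V k) (\<lambda>x. avg (V k) (\<lambda>y. avg (V k) (\<lambda>z.
        ?\<Phi> (B *\<^sub>v x) (B *\<^sub>v y) (B *\<^sub>v z)))))"
    unfolding fourier_fourth_moment
  proof (intro avg_cong refl)
    fix B :: "bit mat" and x y z
    assume "B \<in> carrier_mat n k" "x \<in> V k" "y \<in> V k" "z \<in> V k"
    then have "B *\<^sub>v (x + y + z) = B *\<^sub>v (x + y) + B *\<^sub>v z" "B *\<^sub>v (x + y) = B *\<^sub>v x + B *\<^sub>v y"
      by (blast intro: mult_add_distrib_mat_vec add_carrier_vec)+
    then show "f (B *\<^sub>v x) * f (B *\<^sub>v y) * f (B *\<^sub>v z) * f (B *\<^sub>v (x + y + z))
      = ?\<Phi> (B *\<^sub>v x) (B *\<^sub>v y) (B *\<^sub>v z)"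
      by (simp only:)
  qed
  moreover have "\<bar>?\<Phi> a b c\<bar> \<le> 1" if "a \<in> V n" "b \<in> V n" "c \<in> V n" for a b c
    using that by (simp add: abs_mult sign_abs[OF f])
  ultimately show ?thesis
    using avg_random_matrix_triple[of n ?\<Phi> 1 k]
    by (simp add: fourier_fourth_moment[of n f])
qed

text \<open>
  The tangent bound \<open>x^4 \<ge> \<mu>^4 + 4 \<mu>^3 (x - \<mu>)\<close> reduces the contribution of \<open>L\<close> to first moments;
  matrices that are not injective on \<open>L\<close> are charged to the kernel term.
\<close>

lemma fourth_moment_off_image:
  fixes \<rho> :: real
  assumes W: "W \<subseteq> V n" "0\<^sub>v n \<in> W" "\<And>x y. x \<in> W \<Longrightarrow> y \<in> W \<Longrightarrow> x + y \<in> W"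
    and L: "L \<subseteq> W" "\<And>S. S \<in> V n \<Longrightarrow> S \<notin> L \<Longrightarrow> \<bar>fourier_coeff n f S\<bar> \<le> \<rho>"
  shows "avg (carrier_mat n k) (\<lambda>B. \<Sum>u\<in>V k - (\<lambda>S. transpose_mat B *\<^sub>v S) ` L. restricted_coeff k f B u ^ 4)
    \<le> \<rho>\<^sup>2 + (14 + 56 * real (card L) + 14 * real (card L) * real (card W)) / 2 ^ k"
proof -
  have fin: "finite W" "finite L"
    using W(1) L(1) finite_V[of n] finite_subset by metis+
  have LV: "L \<subseteq> V n" using W L by auto
  let ?F = "restricted_coeff k f" and ?t = "\<lambda>B S. transpose_mat B *\<^sub>v S"
  let ?kern = "\<lambda>B. \<Sum>w\<in>W - {0\<^sub>v n}. of_bool (?t B w = 0\<^sub>v k) :: real"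
  let ?N = "carrier_mat n k :: bit mat set"
  \<comment> \<open>If \<open>B\<close> kills a nonzero element of \<open>W\<close>, the sum over
    \<open>L\<close> may count an image twice, but it is at most \<open>card L\<close>, which
    \<open>?kern B \<ge> 1\<close> pays for. Otherwise the images are distinct and the subtraction
    is exact.\<close>
  have pointwise: "(\<Sum>u\<in>V k - ?t B ` L. ?F B u ^ 4)
      \<le> (\<Sum>u\<in>V k. ?F B u ^ 4) - (\<Sum>S\<in>L. ?F B (?t B S) ^ 4) + real (card L) * ?kern B"
    if B: "B \<in> ?N" for B
  proof (cases "\<exists>w\<in>W - {0\<^sub>v n}. ?t B w = 0\<^sub>v k")
    case True
    then obtain w where w: "w \<in> W - {0\<^sub>v n}" "?t B w = 0\<^sub>v k" by blast
    have "(\<Sum>w\<in>{w}. of_bool (?t B w = 0\<^sub>v k)) \<le> ?kern B"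
      using w fin by (intro sum_mono2) auto
    then have "1 \<le> ?kern B" using w(2) by simp
    then have "real (card L) * 1 \<le> real (card L) * ?kern B"
      by (intro mult_left_mono) auto
    moreover have "(\<Sum>S\<in>L. ?F B (?t B S) ^ 4) \<le> real (card L) * 1"
    proof (rule sum_bounded_above)
      fix S
      have "\<bar>?F B (?t B S)\<bar> ^ 4 \<le> 1"
        using restricted_coeff_bound[OF f B] by (intro power_le_one) auto
      then show "?F B (?t B S) ^ 4 \<le> 1" by simp
    qed
    moreover have "(\<Sum>u\<in>V k - ?t B ` L. ?F B u ^ 4) \<le> (\<Sum>u\<in>V k. ?F B u ^ 4)"
      by (intro sum_mono2 finite_V) auto
    ultimately show ?thesis by linarith
  next
    case False
    have "inj_on (?t B) L"
    proof (rule inj_onI)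
      fix S S' assume SS: "S \<in> L" "S' \<in> L" and eq: "?t B S = ?t B S'"
      have S: "S \<in> V n" "S' \<in> V n" using SS LV by auto
      have "?t B (S + S') = ?t B S + ?t B S'"
        using S B by (intro mult_add_distrib_mat_vec[of _ k n]) auto
      also have "\<dots> = 0\<^sub>v k"
        using B by (simp add: eq bvec_add_self)
      finally have "S + S' = 0\<^sub>v n"
        using False W(3) SS L(1) by blast
      then show "S = S'" using S by (simp add: add_eq_zero_bvec)
    qed
    then have "(\<Sum>S\<in>L. ?F B (?t B S) ^ 4) = (\<Sum>u\<in>?t B ` L. ?F B u ^ 4)"
      by (simp add: sum.reindex)
    moreover have "?t B ` L \<subseteq> V k" using B by auto
    then have "(\<Sum>u\<in>V k. ?F B u ^ 4) = (\<Sum>u\<in>V k - ?t B ` L. ?F B u ^ 4) + (\<Sum>u\<in>?t B ` L. ?F B u ^ 4)"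
      by (rule sum.subset_diff) (rule finite_V)
    moreover have "0 \<le> real (card L) * ?kern B"
      by (intro mult_nonneg_nonneg sum_nonneg) auto
    ultimately show ?thesis by linarith
  qed
  have main: "avg ?N (\<lambda>B. \<Sum>u\<in>V k - ?t B ` L. ?F B u ^ 4)
    \<le> avg ?N (\<lambda>B. \<Sum>u\<in>V k. ?F B u ^ 4) - (\<Sum>S\<in>L. avg ?N (\<lambda>B. ?F B (?t B S) ^ 4))
      + real (card L) * (\<Sum>w\<in>W - {0\<^sub>v n}. avg ?N (\<lambda>B. of_bool (?t B w = 0\<^sub>v k)))"
    unfolding avg_sum[symmetric] avg_cmult[symmetric] avg_diff[symmetric] avg_add[symmetric]
    by (rule avg_mono) (use pointwise in simp)
  have "(\<Sum>w\<in>W - {0\<^sub>v n}. avg ?N (\<lambda>B. of_bool (?t B w = 0\<^sub>v k))) \<le> real (card W) * (14 / 2 ^ k)"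
  proof -
    have "(\<Sum>w\<in>W - {0\<^sub>v n}. avg ?N (\<lambda>B. of_bool (?t B w = 0\<^sub>v k))) \<le> real (card (W - {0\<^sub>v n})) * (14 / 2 ^ k)"
      using W(1) by (intro sum_bounded_above prob_transpose_kernel) auto
    also have "\<dots> \<le> real (card W) * (14 / 2 ^ k)"
      using fin by (intro mult_right_mono) (auto intro: card_mono)
    finally show ?thesis .
  qed
  then have kern: "real (card L) * (\<Sum>w\<in>W - {0\<^sub>v n}. avg ?N (\<lambda>B. of_bool (?t B w = 0\<^sub>v k)))
      \<le> real (card L) * (real (card W) * (14 / 2 ^ k))"
    by (intro mult_left_mono) auto
  have heavy: "(\<Sum>S\<in>L. fourier_coeff n f S ^ 4 - 56 / 2 ^ k) \<le> (\<Sum>S\<in>L. avg ?N (\<lambda>B. ?F B (?t B S) ^ 4))"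
  proof (rule sum_mono)
    fix S assume "S \<in> L"
    then have S: "S \<in> V n" using LV by auto
    let ?\<mu> = "fourier_coeff n f S"
    have "\<bar>?\<mu> ^ 3\<bar> \<le> 1"
      using fourier_coeff_bound[OF f, of S] by (simp add: power_abs power_le_one)
    \<comment> \<open>The slope of the tangent is at most \<open>4\<close> in absolute value, so the
      bias \<open>14 / 2 ^ k\<close> of the mean costs \<open>56 / 2 ^ k\<close>.\<close>
    then have "\<bar>4 * ?\<mu> ^ 3 * (avg ?N (\<lambda>B. ?F B (?t B S)) - ?\<mu>)\<bar> \<le> 4 * (14 / 2 ^ k)"
      unfolding abs_mult using mean_restricted_coeff[OF S, of k]
      by (intro mult_mono) auto
    then have "?\<mu> ^ 4 - 56 / 2 ^ k \<le> ?\<mu> ^ 4 + 4 * ?\<mu> ^ 3 * (avg ?N (\<lambda>B. ?F B (?t B S)) - ?\<mu>)"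
      by (simp add: abs_le_iff)
    also have "\<dots> = avg ?N (\<lambda>B. ?\<mu> ^ 4 + 4 * ?\<mu> ^ 3 * (?F B (?t B S) - ?\<mu>))"
      by (simp add: avg_add avg_cmult avg_diff avg_const_mat)
    also have "\<dots> \<le> avg ?N (\<lambda>B. ?F B (?t B S) ^ 4)"
    proof (rule avg_mono)
      fix B
      let ?z = "?F B (?t B S)"
      \<comment> \<open>The gap between the fourth power and its tangent is a square times a sum of
        squares.\<close>
      have "?z ^ 4 - (?\<mu> ^ 4 + 4 * ?\<mu> ^ 3 * (?z - ?\<mu>)) = (?z - ?\<mu>)\<^sup>2 * ((?z + ?\<mu>)\<^sup>2 + 2 * ?\<mu>\<^sup>2)"
        by (simp add: power4_eq_xxxx power3_eq_cube power2_eq_square algebra_simps)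
      also have "\<dots> \<ge> 0" by simp
      finally show "?\<mu> ^ 4 + 4 * ?\<mu> ^ 3 * (?z - ?\<mu>) \<le> ?z ^ 4" by linarith
    qed
    finally show "?\<mu> ^ 4 - 56 / 2 ^ k \<le> avg ?N (\<lambda>B. ?F B (?t B S) ^ 4)" .
  qed
  have split:  "(\<Sum>S\<in>V n. fourier_coeff n f S ^ 4)
      = (\<Sum>S\<in>V n - L. fourier_coeff n f S ^ 4) + (\<Sum>S\<in>L. fourier_coeff n f S ^ 4)"
    by (rule sum.subset_diff[OF LV finite_V])
  \<comment> \<open>Two of the four factors are bounded by \<open>\<rho>\<close>; Parseval sums the
    remaining square.\<close>
  have light: "(\<Sum>S\<in>V n - L. fourier_coeff n f S ^ 4) \<le> \<rho>\<^sup>2"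
  proof -
    have "(\<Sum>S\<in>V n - L. fourier_coeff n f S ^ 4) \<le> (\<Sum>S\<in>V n - L. \<rho>\<^sup>2 * (fourier_coeff n f S)\<^sup>2)"
    proof (rule sum_mono)
      fix S assume "S \<in> V n - L"
      then have "(fourier_coeff n f S)\<^sup>2 \<le> \<rho>\<^sup>2"
        using L(2) by (intro abs_le_square_iff[THEN iffD1]) fastforce
      then have "(fourier_coeff n f S)\<^sup>2 * (fourier_coeff n f S)\<^sup>2 \<le> \<rho>\<^sup>2 * (fourier_coeff n f S)\<^sup>2"
        by (intro mult_right_mono) auto
      then show "fourier_coeff n f S ^ 4 \<le> \<rho>\<^sup>2 * (fourier_coeff n f S)\<^sup>2"
        by (simp add: power4_eq_xxxx power2_eq_square mult.assoc)
    qed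
    also have "\<dots> \<le> \<rho>\<^sup>2 * (\<Sum>S\<in>V n. (fourier_coeff n f S)\<^sup>2)"
      unfolding sum_distrib_left[symmetric]
      by (intro mult_left_mono sum_mono2 finite_V) auto
    finally show ?thesis by (simp add: parseval_sign[OF f])
  qed
  have "(\<Sum>S\<in>L. fourier_coeff n f S ^ 4 - 56 / 2 ^ k)
      = (\<Sum>S\<in>L. fourier_coeff n f S ^ 4) - real (card L) * (56 / 2 ^ k)"
    by (simp add: sum_subtractf)
  moreover have "(14 + 56 * real (card L) + 14 * real (card L) * real (card W)) / 2 ^ k
      = 14 / 2 ^ k + real (card L) * (56 / 2 ^ k) + real (card L) * (real (card W) * (14 / 2 ^ k))"
    by (simp add: add_divide_distrib mult_ac)
  ultimately show ?thesis
    using main kern heavy split light fourth_moment_restricted_coeff[of k] by linarith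
qed

text \<open>A union bound over the three conditions: the expected number of killed elements of
  \<open>W\<close>, Chebyshev's inequality at each character of \<open>L\<close>, and Markov's
  inequality for the fourth powers off the image of \<open>L\<close>.\<close>

lemma prob_not_good_matrix:
  fixes \<rho> \<theta> :: real
  assumes W: "W \<subseteq> V n" "0\<^sub>v n \<in> W" "\<And>x y. x \<in> W \<Longrightarrow> y \<in> W \<Longrightarrow> x + y \<in> W"
    and L: "L \<subseteq> W" "\<And>S. S \<in> V n \<Longrightarrow> S \<notin> L \<Longrightarrow> \<bar>fourier_coeff n f S\<bar> \<le> \<rho>"
    and \<theta>: "0 < \<theta>"
  shows "avg (carrier_mat n k) (\<lambda>B. of_bool (\<not> good_matrix n k f W L \<theta> B))
    \<le> real (card W) * (14 / 2 ^ k) + real (card L) * (56 / 2 ^ k) / \<theta>\<^sup>2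
      + (\<rho>\<^sup>2 + (14 + 56 * real (card L) + 14 * real (card L) * real (card W)) / 2 ^ k) / \<theta> ^ 4"
proof -
  have fin: "finite W" "finite L"
    using W(1) L(1) finite_V[of n] finite_subset by metis+
  have LV: "L \<subseteq> V n" using W L by auto
  let ?F = "restricted_coeff k f" and ?t = "\<lambda>B S. transpose_mat B *\<^sub>v S"
  let ?N = "carrier_mat n k :: bit mat set"
  let ?a = "\<lambda>B. \<Sum>w\<in>W - {0\<^sub>v n}. of_bool (?t B w = 0\<^sub>v k) :: real"
  let ?b = "\<lambda>B. (\<Sum>S\<in>L. (?F B (?t B S) - fourier_coeff n f S)\<^sup>2) / \<theta>\<^sup>2"
  let ?c = "\<lambda>B. (\<Sum>u\<in>V k - ?t B ` L. ?F B u ^ 4) / \<theta> ^ 4"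
  \<comment> \<open>Markov's inequality before averaging: a sum of nonnegative terms, one of which
    is at least \<open>1\<close>, dominates an indicator.\<close>
  have ge1: "of_bool P \<le> sum h A" if "P" "finite A" "x \<in> A" "1 \<le> h x" "\<And>x. x \<in> A \<Longrightarrow> 0 \<le> h x"
    for P and h :: "bvec \<Rightarrow> real" and x A
    using member_le_sum[of x A h] that by simp
  have "of_bool (\<not> good_matrix n k f W L \<theta> B) \<le> ?a B + ?b B + ?c B" if B: "B \<in> ?N" for B
  proof -
    have nn: "0 \<le> ?a B" "0 \<le> ?b B" "0 \<le> ?c B"
      by (auto intro!: sum_nonneg divide_nonneg_nonneg)
    consider "good_matrix n k f W L \<theta> B"
      | w where "w \<in> W - {0\<^sub>v n}" "?t B w = 0\<^sub>v k"
      | S where "S \<in> L" "\<theta> < \<bar>?F B (?t B S) - fourier_coeff n f S\<bar>"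
      | u where "u \<in> V k - ?t B ` L" "\<theta> < \<bar>?F B u\<bar>"
      unfolding good_matrix_def by force
    then show ?thesis
    proof cases
      case 1
      then have "of_bool (\<not> good_matrix n k f W L \<theta> B) = (0 :: real)" by simp
      then show ?thesis using nn by linarith
    next
      case 2
      then have "1 \<le> ?a B"
        using ge1[of True "W - {0\<^sub>v n}" w "\<lambda>w. of_bool (?t B w = 0\<^sub>v k)"] fin by simp
      then show ?thesis using nn by (simp add: of_bool_def)
    next
      case 3
      then have "\<theta>\<^sup>2 \<le> (?F B (?t B S) - fourier_coeff n f S)\<^sup>2"
        using \<theta> by (intro abs_le_square_iff[THEN iffD1]) auto
      then have "1 \<le> ?b B"
        unfolding sum_divide_distrib
        using ge1[of True L S "\<lambda>S. (?F B (?t B S) - fourier_coeff n f S)\<^sup>2 / \<theta>\<^sup>2"] fin 3(1) \<theta> by simp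
      then show ?thesis using nn by (simp add: of_bool_def)
    next
      case 4
      then have "\<theta> ^ 4 \<le> \<bar>?F B u\<bar> ^ 4"
        using \<theta> by (intro power_mono) auto
      then have "1 \<le> ?c B"
        unfolding sum_divide_distrib
        using ge1[of True "V k - ?t B ` L" u "\<lambda>u. ?F B u ^ 4 / \<theta> ^ 4"] finite_V[of k] 4(1) \<theta> by simp
      then show ?thesis using nn by (simp add: of_bool_def)
    qed
  qed
  then have "avg ?N (\<lambda>B. of_bool (\<not> good_matrix n k f W L \<theta> B)) \<le> avg ?N (\<lambda>B. ?a B + ?b B + ?c B)"
    by (rule avg_mono)
  also have "\<dots> = (\<Sum>w\<in>W - {0\<^sub>v n}. avg ?N (\<lambda>B. of_bool (?t B w = 0\<^sub>v k)))
      + (\<Sum>S\<in>L. avg ?N (\<lambda>B. (?F B (?t B S) - fourier_coeff n f S)\<^sup>2)) / \<theta>\<^sup>2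
      + avg ?N (\<lambda>B. \<Sum>u\<in>V k - ?t B ` L. ?F B u ^ 4) / \<theta> ^ 4"
    by (simp only: avg_add avg_sum avg_divide)
  also have "\<dots> \<le> real (card W) * (14 / 2 ^ k) + real (card L) * (56 / 2 ^ k) / \<theta>\<^sup>2
      + (\<rho>\<^sup>2 + (14 + 56 * real (card L) + 14 * real (card L) * real (card W)) / 2 ^ k) / \<theta> ^ 4"
  proof (intro add_mono divide_right_mono)
    have "(\<Sum>w\<in>W - {0\<^sub>v n}. avg ?N (\<lambda>B. of_bool (?t B w = 0\<^sub>v k))) \<le> real (card (W - {0\<^sub>v n})) * (14 / 2 ^ k)"
      using W(1) by (intro sum_bounded_above prob_transpose_kernel) auto
    also have "\<dots> \<le> real (card W) * (14 / 2 ^ k)"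
      using fin by (intro mult_right_mono) (auto intro: card_mono)
    finally show "(\<Sum>w\<in>W - {0\<^sub>v n}. avg ?N (\<lambda>B. of_bool (?t B w = 0\<^sub>v k))) \<le> \<dots>" .
    show "(\<Sum>S\<in>L. avg ?N (\<lambda>B. (?F B (?t B S) - fourier_coeff n f S)\<^sup>2)) \<le> real (card L) * (56 / 2 ^ k)"
      using LV by (intro sum_bounded_above variance_restricted_coeff) auto
    show "avg ?N (\<lambda>B. \<Sum>u\<in>V k - ?t B ` L. ?F B u ^ 4)
      \<le> \<rho>\<^sup>2 + (14 + 56 * real (card L) + 14 * real (card L) * real (card W)) / 2 ^ k"
      by (rule fourth_moment_off_image) (use W L in auto)
  qed (use \<theta> in auto)
  finally show ?thesis .
qed

end

subsection \<open>Sampling\<close>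

text \<open>The coordinates of a uniform sequence are independent and identically
  distributed.\<close>

lemma avg_PiE_prod:
  assumes "finite A" "A \<noteq> {}"
  shows "avg ({..<m} \<rightarrow>\<^sub>E A) (\<lambda>xs. \<Prod>j<m. h (xs j)) = avg A h ^ m"
proof -
  have "(\<Sum>xs\<in>{..<m} \<rightarrow>\<^sub>E A. \<Prod>j<m. h (xs j)) = (\<Prod>j<m. \<Sum>x\<in>A. h x)"
    using assms by (subst prod_sum_PiE) auto
  then show ?thesis
    by (simp add: avg_def card_PiE power_divide)
qed

text \<open>For \<open>y = - x < 0\<close> the claim amounts to
  \<open>1 \<le> (1 - x + x^2) * exp x\<close>, which follows from the quadratic Taylor lower bound
  on \<open>exp x\<close>.\<close>

lemma exp_le_quadratic:
  fixes y :: real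
  assumes "\<bar>y\<bar> \<le> 1"
  shows "exp y \<le> 1 + y + y\<^sup>2"
proof (cases "0 \<le> y")
  case True
  then show ?thesis using assms exp_bound[of y] by simp
next
  case False
  define x where "x = - y"
  have x: "0 \<le> x" using False by (simp add: x_def)
  have "(1 - x + x\<^sup>2) * (1 + x + x\<^sup>2 / 2) = 1 + x\<^sup>2 / 2 + x ^ 3 / 2 + x ^ 4 / 2"
    by (simp add: power4_eq_xxxx power3_eq_cube power2_eq_square field_simps)
  also have "\<dots> \<ge> 1" using x by simp
  finally have 1: "1 \<le> (1 - x + x\<^sup>2) * (1 + x + x\<^sup>2 / 2)" .
  have p: "0 < 1 - x + x\<^sup>2"
    using assms x by (cases "x = 0") (auto simp: x_def abs_if split: if_splits intro: add_nonneg_pos)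
  have "(1 - x + x\<^sup>2) * (1 + x + x\<^sup>2 / 2) \<le> (1 - x + x\<^sup>2) * exp x"
    using exp_lower_Taylor_quadratic[OF x] p by (intro mult_left_mono) auto
  with 1 have "1 \<le> (1 - x + x\<^sup>2) * exp x" by linarith
  then have "exp (- x) \<le> 1 - x + x\<^sup>2"
    by (simp add: exp_minus field_simps)
  then show ?thesis by (simp add: x_def)
qed

lemma chernoff_upper:
  fixes Y :: "'a \<Rightarrow> real"
  assumes A: "finite A" "A \<noteq> {}" and Y: "\<And>x. x \<in> A \<Longrightarrow> \<bar>Y x\<bar> \<le> 2" and mean: "avg A Y = 0"
    and \<theta>: "0 < \<theta>" "\<theta> \<le> 1"
  shows "avg ({..<m} \<rightarrow>\<^sub>E A) (\<lambda>xs. of_bool (real m * \<theta> < (\<Sum>j<m. Y (xs j)))) \<le> exp (- (real m * \<theta>\<^sup>2 / 16))"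
proof -
  \<comment> \<open>Each factor contributes an exponent of at most
    \<open>4 * l^2 - l * \<theta>\<close>; this choice of \<open>l\<close> minimizes it, with
    minimum \<open>- \<theta>^2 / 16\<close>.\<close>
  define l where "l = \<theta> / 8"
  have l: "0 < l" "2 * l \<le> 1" using \<theta> by (auto simp: l_def)
  have "avg A (\<lambda>x. exp (l * Y x)) \<le> avg A (\<lambda>x. 1 + l * Y x + 4 * l\<^sup>2)"
  proof (rule avg_mono)
    fix x assume "x \<in> A"
    have "\<bar>l * Y x\<bar> \<le> l * 2"
      using Y[OF \<open>x \<in> A\<close>] l by (simp add: abs_mult)
    then have "\<bar>l * Y x\<bar> \<le> 1" and "\<bar>l * Y x\<bar>\<^sup>2 \<le> (l * 2)\<^sup>2"
      using l by (linarith, intro power_mono) simp_all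
    then show "exp (l * Y x) \<le> 1 + l * Y x + 4 * l\<^sup>2"
      using exp_le_quadratic[of "l * Y x"] by (simp add: power_mult_distrib)
  qed
  also have "\<dots> = 1 + 4 * l\<^sup>2"
    using A by (simp add: avg_add avg_cmult mean avg_const)
  also have "\<dots> \<le> exp (4 * l\<^sup>2)"
    by (rule exp_ge_add_one_self)
  finally have mgf: "avg A (\<lambda>x. exp (l * Y x)) \<le> exp (4 * l\<^sup>2)" .
  have "avg ({..<m} \<rightarrow>\<^sub>E A) (\<lambda>xs. of_bool (real m * \<theta> < (\<Sum>j<m. Y (xs j))))
      \<le> avg ({..<m} \<rightarrow>\<^sub>E A) (\<lambda>xs. exp (- (l * real m * \<theta>)) * (\<Prod>j<m. exp (l * Y (xs j))))"
  proof (rule avg_mono)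
    fix xs
    have "of_bool (real m * \<theta> < (\<Sum>j<m. Y (xs j))) \<le> exp (l * ((\<Sum>j<m. Y (xs j)) - real m * \<theta>))"
      using l by (auto simp: of_bool_def)
    also have "\<dots> = exp (- (l * real m * \<theta>)) * (\<Prod>j<m. exp (l * Y (xs j)))"
      by (simp add: exp_sum[symmetric] exp_add[symmetric] sum_distrib_left algebra_simps)
    finally show "of_bool (real m * \<theta> < (\<Sum>j<m. Y (xs j))) \<le> \<dots>" .
  qed
  also have "\<dots> = exp (- (l * real m * \<theta>)) * avg A (\<lambda>x. exp (l * Y x)) ^ m"
    by (simp only: avg_cmult avg_PiE_prod[OF A, of _ "\<lambda>x. exp (l * Y x)"])
  also have "\<dots> \<le> exp (- (l * real m * \<theta>)) * exp (4 * l\<^sup>2) ^ m"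
    by (intro mult_left_mono power_mono mgf avg_nonneg) auto
  also have "\<dots> = exp (- (real m * \<theta>\<^sup>2 / 16))"
    by (simp add: exp_of_nat_mult[symmetric] exp_add[symmetric] l_def power2_eq_square)
  finally show ?thesis .
qed

definition empirical_coeff :: "nat \<Rightarrow> (bvec \<Rightarrow> real) \<Rightarrow> (nat \<Rightarrow> bvec) \<Rightarrow> bvec \<Rightarrow> real" where
  "empirical_coeff m q xs u = (\<Sum>j<m. q (xs j) * chi u (xs j)) / real m"

text \<open>One sample serves all coefficients: the Chernoff bound for each sign and each of the
  \<open>2 ^ k\<close> characters survives a union bound.\<close>

lemma prob_sampling_error:
  assumes q: "q \<in> V k \<rightarrow> {- 1, 1}" and \<theta>: "0 < \<theta>" "\<theta> \<le> 1" and m: "0 < m"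
  shows "avg ({..<m} \<rightarrow>\<^sub>E V k)
      (\<lambda>xs. of_bool (\<exists>u\<in>V k. \<theta> < \<bar>empirical_coeff m q xs u - fourier_coeff k q u\<bar>))
    \<le> 2 ^ k * (2 * exp (- (real m * \<theta>\<^sup>2 / 16)))"
proof -
  let ?X = "{..<m} \<rightarrow>\<^sub>E V k"
  let ?Y = "\<lambda>u x. q x * chi u x - fourier_coeff k q u"
  let ?e = "exp (- (real m * \<theta>\<^sup>2 / 16))"
  have bound: "\<bar>?Y u x\<bar> \<le> 2" if "x \<in> V k" for u x
    using fourier_coeff_bound[OF q, of u] sign_abs[OF q that]
    by (intro order_trans[OF abs_triangle_ineq4]) (simp add: abs_mult)
  have mean: "avg (V k) (?Y u) = 0" for u
    by (simp add: avg_diff avg_const_V fourier_coeff_avg)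
  have upper: "avg ?X (\<lambda>xs. of_bool (real m * \<theta> < (\<Sum>j<m. ?Y u (xs j)))) \<le> ?e" for u
    by (rule chernoff_upper) (use bound mean \<theta> finite_V V_nonempty in auto)
  have lower: "avg ?X (\<lambda>xs. of_bool (real m * \<theta> < (\<Sum>j<m. - ?Y u (xs j)))) \<le> ?e" for u
  proof (rule chernoff_upper[OF finite_V V_nonempty _ _ \<theta>])
    show "avg (V k) (\<lambda>x. - ?Y u x) = 0" unfolding avg_minus mean by simp
  qed (use bound in \<open>metis abs_minus_cancel\<close>)
  have "of_bool (\<exists>u\<in>V k. \<theta> < \<bar>empirical_coeff m q xs u - fourier_coeff k q u\<bar>)
      \<le> (\<Sum>u\<in>V k. of_bool (real m * \<theta> < (\<Sum>j<m. ?Y u (xs j)))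
            + of_bool (real m * \<theta> < (\<Sum>j<m. - ?Y u (xs j))) :: real)" (is "_ \<le> (\<Sum>u\<in>V k. ?s u)") for xs
  proof (cases "\<exists>u\<in>V k. \<theta> < \<bar>empirical_coeff m q xs u - fourier_coeff k q u\<bar>")
    case True
    then obtain u where u: "u \<in> V k" "\<theta> < \<bar>empirical_coeff m q xs u - fourier_coeff k q u\<bar>" by blast
    have e: "(\<Sum>j<m. ?Y u (xs j)) = real m * (empirical_coeff m q xs u - fourier_coeff k q u)"
      using m by (simp add: empirical_coeff_def sum_subtractf field_simps)
    have e': "(\<Sum>j<m. - ?Y u (xs j)) = - (\<Sum>j<m. ?Y u (xs j))"
      by (simp only: sum_negf)
    have "real m * \<theta> < real m * \<bar>empirical_coeff m q xs u - fourier_coeff k q u\<bar>"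
      using u m by simp
    then have "real m * \<theta> < (\<Sum>j<m. ?Y u (xs j)) \<or> real m * \<theta> < (\<Sum>j<m. - ?Y u (xs j))"
      unfolding e' e by (auto simp: abs_if right_diff_distrib split: if_splits)
    then have "1 \<le> ?s u" by (auto simp: of_bool_def)
    also have "\<dots> \<le> (\<Sum>u\<in>V k. ?s u)"
      using u(1) by (intro member_le_sum finite_V) auto
    finally show ?thesis by (simp add: of_bool_def)
  next
    case False
    then have "of_bool (\<exists>u\<in>V k. \<theta> < \<bar>empirical_coeff m q xs u - fourier_coeff k q u\<bar>) = (0 :: real)"
      by (simp only: of_bool_eq)
    also have "0 \<le> (\<Sum>u\<in>V k. ?s u)" by (intro sum_nonneg) simp
    finally show ?thesis .
  qed
  then have "avg ?X (\<lambda>xs. of_bool (\<exists>u\<in>V k. \<theta> < \<bar>empirical_coeff m q xs u - fourier_coeff k q u\<bar>))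
    \<le> avg ?X (\<lambda>xs. \<Sum>u\<in>V k. of_bool (real m * \<theta> < (\<Sum>j<m. ?Y u (xs j)))
            + of_bool (real m * \<theta> < (\<Sum>j<m. - ?Y u (xs j))))"
    by (rule avg_mono)
  also have "\<dots> = (\<Sum>u\<in>V k. avg ?X (\<lambda>xs. of_bool (real m * \<theta> < (\<Sum>j<m. ?Y u (xs j))))
            + avg ?X (\<lambda>xs. of_bool (real m * \<theta> < (\<Sum>j<m. - ?Y u (xs j)))))"
    by (simp only: avg_sum avg_add)
  also have "\<dots> \<le> real (card (V k)) * (?e + ?e)"
    by (intro sum_bounded_above add_mono upper lower)
  finally show ?thesis by (simp add: card_V)
qed

subsection \<open>Linear algebra over \<open>F_2\<close>\<close>

text \<open>The only scalars are \<open>0\<close> and \<open>1\<close>, so closure under addition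
  together with zero makes a linear subspace, and additivity makes a map linear.\<close>

definition subsp :: "nat \<Rightarrow> bvec set \<Rightarrow> bool" where
  "subsp n W \<longleftrightarrow> W \<subseteq> V n \<and> 0\<^sub>v n \<in> W \<and> (\<forall>x\<in>W. \<forall>y\<in>W. x + y \<in> W)"

lemma subspD:
  assumes "subsp n W"
  shows "W \<subseteq> V n" "0\<^sub>v n \<in> W" "\<And>x y. x \<in> W \<Longrightarrow> y \<in> W \<Longrightarrow> x + y \<in> W" "\<And>x. x \<in> W \<Longrightarrow> x \<in> V n"
  using assms by (auto simp: subsp_def)

lemma bvec_add_swap:
  assumes "x \<in> V n" "y \<in> V n" "a \<in> V n" "b \<in> V n"
  shows "(x + a) + (y + b) = (x + y) + (a + b)"
  using assms by (intro eq_vecI) auto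

lemma subsp_insert:
  assumes W: "subsp n W" and x: "x \<in> V n"
  shows "subsp n (W \<union> (\<lambda>w. x + w) ` W)"
proof -
  note W = subspD[OF W]
  have 1: "x + w + (x + w') = w + w'" if "w \<in> W" "w' \<in> W" for w w'
    using that W(4) x by (subst bvec_add_swap[of _ n]) (auto simp: bvec_add_self)
  have 2: "x + w + w' = x + (w + w')" "w' + (x + w) = x + (w' + w)" if "w \<in> W" "w' \<in> W" for w w'
    using that W(4) x by (auto intro!: eq_vecI simp: add.left_commute dest!: W(4))
  show ?thesis
    unfolding subsp_def
    using W x by (auto simp: 1 2 bvec_add_cancel_left[OF x])
qed

text \<open>Adjoining one vector adds a single coset of the subspace, which at most doubles
  it.\<close>

lemma ex_small_subsp:
  assumes U: "subsp n U" and P: "finite P" "P \<subseteq> V n"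
  shows "\<exists>W. subsp n W \<and> U \<subseteq> W \<and> P \<subseteq> W \<and> card W \<le> card U * 2 ^ card P"
  using P
proof (induction P rule: finite_induct)
  case empty
  then show ?case using U by auto
next
  case (insert x P)
  then obtain W where W: "subsp n W" "U \<subseteq> W" "P \<subseteq> W" "card W \<le> card U * 2 ^ card P" by auto
  have "finite W" using subspD(1)[OF W(1)] finite_V finite_subset by blast
  have "card (W \<union> (\<lambda>w. x + w) ` W) \<le> card W + card W"
    using card_Un_le[of W "(\<lambda>w. x + w) ` W"] card_image_le[OF \<open>finite W\<close>, of "\<lambda>w. x + w"] by linarith
  also have "\<dots> \<le> card U * 2 ^ card (insert x P)"
    using W(4) insert.hyps by simp
  finally have "card (W \<union> (\<lambda>w. x + w) ` W) \<le> card U * 2 ^ card (insert x P)" .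
  moreover have "x \<in> (\<lambda>w. x + w) ` W"
    using insert.prems subspD(2)[OF W(1)] by (intro image_eqI[of _ _ "0\<^sub>v n"]) auto
  ultimately show ?case
    using subsp_insert[OF W(1)] W(2,3) insert.prems
    by (intro exI[of _ "W \<union> (\<lambda>w. x + w) ` W"]) auto
qed

lemma subsp_unit_vecs:
  assumes W: "subsp n W" and e: "\<And>j. j < n \<Longrightarrow> unit_vec n j \<in> W"
  shows "W = V n"
proof -
  note W = subspD[OF W]
  \<comment> \<open>Induction on the number \<open>j\<close> of leading coordinates that may be
    nonzero; adding a unit vector clears the last of them.\<close>
  have low: "x \<in> W" if "x \<in> V n" "\<And>i. i < n \<Longrightarrow> j \<le> i \<Longrightarrow> x $ i = 0" "j \<le> n" for x j
    using that
  proof (induction j arbitrary: x)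
    case 0
    then have "x = 0\<^sub>v n" by (intro eq_vecI) auto
    then show ?case using W by simp
  next
    case (Suc j)
    show ?case
    proof (cases "x $ j = 0")
      case True
      have "x $ i = 0" if "i < n" "j \<le> i" for i
        using that True Suc.prems(2)[of i] by (cases "i = j") auto
      then show ?thesis
        using Suc.prems by (intro Suc.IH) auto
    next
      case False
      have "(x + unit_vec n j) $ i = 0" if "i < n" "j \<le> i" for i
        using that False Suc.prems(2)[of i] by (cases "i = j") auto
      then have "x + unit_vec n j \<in> W"
        using Suc.prems by (intro Suc.IH) auto
      then have "x + unit_vec n j + unit_vec n j \<in> W"
        by (rule W(3)) (use e Suc.prems in auto)
      then show ?thesis
        using Suc.prems by (simp only: bvec_add_cancel_right[OF unit_vec_carrier])
    qed
  qed
  have "x \<in> W" if "x \<in> V n" for x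
    using that by (rule low[of _ n]) auto
  then show ?thesis using W(1) by auto
qed

section \<open>Linear maps, complements and projections\<close>

definition additive_on :: "nat \<Rightarrow> (bvec \<Rightarrow> bvec) \<Rightarrow> bool" where
  "additive_on n \<phi> \<longleftrightarrow> (\<forall>x\<in>V n. \<phi> x \<in> V n) \<and> (\<forall>x\<in>V n. \<forall>y\<in>V n. \<phi> (x + y) = \<phi> x + \<phi> y)"

definition lin_bij :: "nat \<Rightarrow> (bvec \<Rightarrow> bvec) \<Rightarrow> bool" where
  "lin_bij n \<phi> \<longleftrightarrow> additive_on n \<phi> \<and> bij_betw \<phi> (V n) (V n)"

lemma additive_onD:
  assumes "additive_on n \<phi>"
  shows "\<And>x. x \<in> V n \<Longrightarrow> \<phi> x \<in> V n" "\<And>x y. x \<in> V n \<Longrightarrow> y \<in> V n \<Longrightarrow> \<phi> (x + y) = \<phi> x + \<phi> y"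
  using assms by (auto simp: additive_on_def)

lemma additive_on_zero:
  assumes "additive_on n \<phi>"
  shows "\<phi> (0\<^sub>v n) = 0\<^sub>v n"
  using additive_onD[OF assms, of "0\<^sub>v n"] additive_onD(2)[OF assms, of "0\<^sub>v n" "0\<^sub>v n"]
  by (simp add: bvec_add_self)

lemma lin_bijD:
  assumes "lin_bij n \<phi>"
  shows "\<And>x. x \<in> V n \<Longrightarrow> \<phi> x \<in> V n" "\<And>x y. x \<in> V n \<Longrightarrow> y \<in> V n \<Longrightarrow> \<phi> (x + y) = \<phi> x + \<phi> y"
    "bij_betw \<phi> (V n) (V n)" "inj_on \<phi> (V n)" "\<phi> (0\<^sub>v n) = 0\<^sub>v n"
  using assms additive_onD[of n \<phi>] additive_on_zero[of n \<phi>] by (auto simp: lin_bij_def bij_betw_def)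

lemma lin_bijI:
  assumes a: "additive_on n \<phi>" and k: "\<And>x. x \<in> V n \<Longrightarrow> \<phi> x = 0\<^sub>v n \<Longrightarrow> x = 0\<^sub>v n"
  shows "lin_bij n \<phi>"
proof -
  note a' = additive_onD[OF a]
  have "inj_on \<phi> (V n)"
  proof (rule inj_onI)
    fix x y assume xy: "x \<in> V n" "y \<in> V n" "\<phi> x = \<phi> y"
    then have "\<phi> (x + y) = 0\<^sub>v n"
      by (simp add: a' bvec_add_self)
    then have "x + y = 0\<^sub>v n" using k xy by auto
    then show "x = y" using xy by (simp add: add_eq_zero_bvec)
  qed
  then have "bij_betw \<phi> (V n) (V n)"
    using endo_inj_surj[OF finite_V _ \<open>inj_on \<phi> (V n)\<close>] a'(1) by (auto simp: bij_betw_def)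
  then show ?thesis using a by (simp add: lin_bij_def)
qed

lemma lin_bij_comp:
  "lin_bij n \<phi> \<Longrightarrow> lin_bij n \<psi> \<Longrightarrow> lin_bij n (\<lambda>x. \<psi> (\<phi> x))"
  using bij_betw_trans[of \<phi> "V n" "V n" \<psi> "V n"]
  by (auto simp: lin_bij_def additive_on_def comp_def)

lemma subsp_image:
  assumes "subsp n W" "lin_bij n \<phi>"
  shows "subsp n (\<phi> ` W)"
proof -
  note W = subspD[OF assms(1)] and \<phi> = lin_bijD[OF assms(2)]
  have "\<phi> x + \<phi> y \<in> \<phi> ` W" if "x \<in> W" "y \<in> W" for x y
    using that W by (subst \<phi>(2)[symmetric]) auto
  moreover have "0\<^sub>v n \<in> \<phi> ` W" using W \<phi>(5) by force
  ultimately show ?thesis using W \<phi> by (auto simp: subsp_def)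
qed

text \<open>A maximal subspace \<open>C\<close> that contains \<open>W\<close> and meets
  \<open>K\<close> trivially is a complement of \<open>K\<close>. The projection sends
  \<open>x\<close> to the unique element of \<open>C\<close> in the coset of \<open>x\<close> modulo
  \<open>K\<close>; if that coset meets \<open>W\<close>, the element is the one in \<open>W\<close>
  because \<open>W \<subseteq> C\<close>.\<close>

lemma ex_projection:
  assumes K: "subsp n K" and W: "subsp n W" and WK: "\<And>x. x \<in> W \<Longrightarrow> x \<in> K \<Longrightarrow> x = 0\<^sub>v n"
  shows "\<exists>\<pi>. additive_on n \<pi> \<and> (\<forall>x\<in>V n. x + \<pi> x \<in> K) \<and> (\<forall>x\<in>V n. \<forall>w\<in>W. x + w \<in> K \<longrightarrow> \<pi> x = w)"
proof -
  define \<C> where "\<C> = {C. subsp n C \<and> W \<subseteq> C \<and> (\<forall>x\<in>C. x \<in> K \<longrightarrow> x = 0\<^sub>v n)}"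
  have "finite \<C>"
    by (rule finite_subset[of _ "Pow (V n)"]) (auto simp: \<C>_def finite_V dest: subspD)
  moreover have "W \<in> \<C>" using W WK by (auto simp: \<C>_def)
  ultimately obtain C where C: "C \<in> \<C>" and max: "\<And>D. D \<in> \<C> \<Longrightarrow> C \<subseteq> D \<Longrightarrow> C = D"
    using finite_has_maximal[of \<C>] by blast
  have Cs: "subsp n C" and CK: "\<And>x. x \<in> C \<Longrightarrow> x \<in> K \<Longrightarrow> x = 0\<^sub>v n" and WC: "W \<subseteq> C"
    using C by (auto simp: \<C>_def)
  note k = subspD[OF K] and c = subspD[OF Cs]
  \<comment> \<open>If \<open>C\<close> missed the coset of \<open>x\<close>, then \<open>x\<close>
    could be adjoined to \<open>C\<close> without meeting \<open>K\<close>. By maximality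
    \<open>x\<close> would already lie in \<open>C\<close>, and then \<open>x + x = 0\<close> lies
    in \<open>K\<close>, a contradiction.\<close>
  have ex: "\<exists>y\<in>C. x + y \<in> K" if x: "x \<in> V n" for x
  proof (rule ccontr)
    assume no: "\<not> (\<exists>y\<in>C. x + y \<in> K)"
    have "C \<union> (\<lambda>w. x + w) ` C \<in> \<C>"
      using subsp_insert[OF Cs x] WC CK no by (auto simp: \<C>_def)
    then have "C = C \<union> (\<lambda>w. x + w) ` C" by (rule max) auto
    moreover have "x \<in> (\<lambda>w. x + w) ` C"
      using x c(2) by (intro image_eqI[of _ _ "0\<^sub>v n"]) auto
    ultimately have "x \<in> C" by blast
    with no have "x + x \<notin> K" by blast
    with x k(2) show False by (simp add: bvec_add_self)
  qed
  have unique: "y = z" if "x \<in> V n" "y \<in> C" "z \<in> C" "x + y \<in> K" "x + z \<in> K" for x y z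
  proof -
    have v: "y \<in> V n" "z \<in> V n" using that c(4) by auto
    have "y + z = (x + x) + (y + z)"
      using that v by (simp add: bvec_add_self)
    also have "\<dots> = (x + y) + (x + z)"
      using that v by (subst bvec_add_swap[of _ n]) auto
    also have "\<dots> \<in> K" using that k(3) by blast
    finally have "y + z = 0\<^sub>v n" using CK c(3) that by blast
    then show ?thesis using v by (simp add: add_eq_zero_bvec)
  qed
  obtain \<pi> where \<pi>: "\<And>x. x \<in> V n \<Longrightarrow> \<pi> x \<in> C \<and> x + \<pi> x \<in> K"
    using ex by metis
  have "\<pi> (x + y) = \<pi> x + \<pi> y" if xy: "x \<in> V n" "y \<in> V n" for x y
  proof (rule unique[of "x + y"])
    have "(x + y) + (\<pi> x + \<pi> y) = (x + \<pi> x) + (y + \<pi> y)"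
      using xy \<pi> c(4) by (intro bvec_add_swap[of _ n, symmetric]) auto
    also have "\<dots> \<in> K" using \<pi> xy k(3) by blast
    finally show "(x + y) + (\<pi> x + \<pi> y) \<in> K" .
    show "x + y + \<pi> (x + y) \<in> K" using \<pi>[OF add_carrier_vec[OF xy]] by blast
  qed (use xy \<pi> c in auto)
  then have "additive_on n \<pi>"
    using \<pi> c(4) by (auto simp: additive_on_def)
  then show ?thesis
    using \<pi> unique WC by (intro exI[of _ \<pi>]) blast
qed

text \<open>
  With projections \<open>\<pi>\<close>, \<open>\<pi>'\<close> along \<open>K\<close> onto complements containing \<open>W\<close> and \<open>U\<close>, respectively, the map
  \<open>x \<mapsto> \<pi> (\<pi>' x) + (x + \<pi>' x)\<close> moves the second complement to the first and fixes \<open>K\<close>.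
\<close>

lemma ex_lin_bij_modulo:
  assumes K: "subsp n K" and U: "subsp n U" "\<And>x. x \<in> U \<Longrightarrow> x \<in> K \<Longrightarrow> x = 0\<^sub>v n"
    and W: "subsp n W" "\<And>x. x \<in> W \<Longrightarrow> x \<in> K \<Longrightarrow> x = 0\<^sub>v n"
  shows "\<exists>\<tau>. lin_bij n \<tau> \<and> (\<forall>x\<in>V n. \<tau> x + x \<in> K) \<and> (\<forall>u\<in>U. \<forall>w\<in>W. u + w \<in> K \<longrightarrow> \<tau> u = w)"
proof -
  obtain \<pi> where \<pi>: "additive_on n \<pi>" "\<And>x. x \<in> V n \<Longrightarrow> x + \<pi> x \<in> K"
    "\<And>x w. x \<in> V n \<Longrightarrow> w \<in> W \<Longrightarrow> x + w \<in> K \<Longrightarrow> \<pi> x = w"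
    using ex_projection[OF K W] by blast
  obtain \<sigma> where \<sigma>: "additive_on n \<sigma>" "\<And>x. x \<in> V n \<Longrightarrow> x + \<sigma> x \<in> K"
    "\<And>x w. x \<in> V n \<Longrightarrow> w \<in> U \<Longrightarrow> x + w \<in> K \<Longrightarrow> \<sigma> x = w"
    using ex_projection[OF K U] by blast
  note p = additive_onD[OF \<pi>(1)] and s = additive_onD[OF \<sigma>(1)] and k = subspD[OF K]
  define \<tau> where "\<tau> x = \<pi> (\<sigma> x) + (x + \<sigma> x)" for x
  have mod: "\<tau> x + x \<in> K" if x: "x \<in> V n" for x
  proof -
    have "b + (x + a) + x = (a + b) + (x + x)" if "a \<in> V n" "b \<in> V n" for a b
      using that x by (intro eq_vecI) (auto simp: ac_simps)
    then have "\<tau> x + x = (\<sigma> x + \<pi> (\<sigma> x)) + (x + x)"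
      using x p(1) s(1) unfolding \<tau>_def by blast
    also have "\<dots> = \<sigma> x + \<pi> (\<sigma> x)"
      using x p s by (simp add: bvec_add_self)
    finally show ?thesis using \<pi>(2) s x by simp
  qed
  have add: "additive_on n \<tau>"
    unfolding additive_on_def
  proof (intro conjI ballI)
    fix x y assume xy: "x \<in> V n" "y \<in> V n"
    then have "(x + y) + (\<sigma> x + \<sigma> y) = (x + \<sigma> x) + (y + \<sigma> y)"
      by (intro bvec_add_swap[symmetric, of _ n] s(1))
    moreover have "\<pi> (\<sigma> x) + \<pi> (\<sigma> y) + ((x + \<sigma> x) + (y + \<sigma> y))
      = (\<pi> (\<sigma> x) + (x + \<sigma> x)) + (\<pi> (\<sigma> y) + (y + \<sigma> y))"
      using xy by (intro bvec_add_swap[of _ n] p(1) s(1) add_carrier_vec)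
    ultimately show "\<tau> (x + y) = \<tau> x + \<tau> y"
      using xy unfolding \<tau>_def by (simp only: p s)
  qed (use p s in \<open>auto simp: \<tau>_def\<close>)
  \<comment> \<open>An element that \<open>\<tau>\<close> kills lies in \<open>K\<close>; there
    \<open>\<sigma>\<close> vanishes and \<open>\<tau>\<close> is the identity.\<close>
  have "x = 0\<^sub>v n" if x: "x \<in> V n" "\<tau> x = 0\<^sub>v n" for x
  proof -
    have "x \<in> K" using mod[OF x(1)] x by simp
    then have "\<sigma> x = 0\<^sub>v n"
      using x subspD(2)[OF U(1)] by (intro \<sigma>(3)) auto
    then have "\<tau> x = x"
      using x additive_on_zero[OF \<pi>(1)] by (simp add: \<tau>_def)
    then show ?thesis using x by simp
  qed
  then have "lin_bij n \<tau>" by (rule lin_bijI[OF add])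
  moreover have "\<tau> u = w" if "u \<in> U" "w \<in> W" "u + w \<in> K" for u w
  proof -
    have v: "u \<in> V n" "w \<in> V n" using that U W by (auto dest: subspD)
    have "\<sigma> u = u" using that v k by (intro \<sigma>(3)) (auto simp: bvec_add_self)
    moreover have "\<pi> u = w" using that v by (intro \<pi>(3)) auto
    ultimately show ?thesis using v by (simp add: \<tau>_def bvec_add_self)
  qed
  ultimately show ?thesis using mod by blast
qed

section \<open>Linear bijections as transposes of invertible matrices\<close>

lemma additive_matrix:
  assumes "additive_on n \<phi>"
  shows "\<exists>N\<in>carrier_mat n n. \<forall>x\<in>V n. N *\<^sub>v x = \<phi> x"
proof -
  note \<phi> = additive_onD[OF assms]
  define N where "N = Matrix.mat n n (\<lambda>(i, j). \<phi> (unit_vec n j) $ i)"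
  have N: "N \<in> carrier_mat n n" by (simp add: N_def)
  have unit: "N *\<^sub>v unit_vec n j = \<phi> (unit_vec n j)" if "j < n" for j
  proof (rule eq_vecI)
    fix i assume "i < dim_vec (\<phi> (unit_vec n j))"
    then have "i < n" using \<phi>(1)[OF unit_vec_carrier, of j] by simp
    then show "(N *\<^sub>v unit_vec n j) $ i = \<phi> (unit_vec n j) $ i"
      using that by (simp add: N_def scalar_prod_right_unit)
  qed (use \<phi>(1)[OF unit_vec_carrier, of j] in \<open>simp add: N_def\<close>)
  \<comment> \<open>The set on which the matrix and the map agree is a subspace, and it contains the
    unit vectors.\<close>
  have "subsp n {x \<in> V n. N *\<^sub>v x = \<phi> x}"
    using N by (auto simp: subsp_def \<phi> additive_on_zero[OF assms] mult_add_distrib_mat_vec[of _ n n])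
  then have "{x \<in> V n. N *\<^sub>v x = \<phi> x} = V n"
    by (rule subsp_unit_vecs) (simp add: unit)
  then show ?thesis using N by blast
qed

lemma mat_eq_by_vec:
  fixes A B :: "bit mat"
  assumes "A \<in> carrier_mat n n" "B \<in> carrier_mat n n" "\<And>x. x \<in> V n \<Longrightarrow> A *\<^sub>v x = B *\<^sub>v x"
  shows "A = B"
proof (rule eq_matI)
  fix i j assume ij: "i < dim_row B" "j < dim_col B"
  have "(A *\<^sub>v unit_vec n j) $ i = (B *\<^sub>v unit_vec n j) $ i"
    using assms(3) by simp
  then show "A $$ (i, j) = B $$ (i, j)"
    using assms(1,2) ij by (simp add: scalar_prod_right_unit)
qed (use assms in auto)

lemma GL_inverse:
  assumes "M \<in> GL n"
  obtains M' where "M' \<in> carrier_mat n n" "M * M' = 1\<^sub>m n" "M' * M = 1\<^sub>m n"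
proof -
  have M: "M \<in> carrier_mat n n" using assms by (simp add: GL_def)
  obtain M' where M': "M * M' = 1\<^sub>m (dim_row M)" "M' * M = 1\<^sub>m (dim_row M')"
    using assms by (auto simp: GL_def invertible_mat_def inverts_mat_def)
  have "dim_row M' = n" "dim_col M' = n"
    using arg_cong[OF M'(1), of dim_col] arg_cong[OF M'(2), of dim_col] M by auto
  then show ?thesis using that M' M by (metis carrier_matI carrier_matD(1))
qed

lemma GL_bij:
  assumes "M \<in> GL n"
  shows "bij_betw (\<lambda>x. M *\<^sub>v x) (V n) (V n)"
proof -
  have M: "M \<in> carrier_mat n n" using assms by (simp add: GL_def)
  obtain M' where M': "M' \<in> carrier_mat n n" "M * M' = 1\<^sub>m n" "M' * M = 1\<^sub>m n"
    using GL_inverse[OF assms] .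
  show ?thesis
    using M M' by (intro bij_betwI[where g = "\<lambda>x. M' *\<^sub>v x"])
      (auto simp: assoc_mult_mat_vec[symmetric, of _ n n _ n] simp del: assoc_mult_mat_vec)
qed

text \<open>The inverse transpose of \<open>M\<close> describes how composition with
  \<open>M\<close> moves the characters.\<close>

lemma lin_bij_of_GL:
  assumes "M \<in> GL n"
  shows "\<exists>\<phi>. lin_bij n \<phi> \<and> (\<forall>S\<in>V n. transpose_mat M *\<^sub>v \<phi> S = S)"
proof -
  have M: "M \<in> carrier_mat n n" using assms by (simp add: GL_def)
  obtain M' where M': "M' \<in> carrier_mat n n" "M * M' = 1\<^sub>m n" "M' * M = 1\<^sub>m n"
    using GL_inverse[OF assms] .
  let ?\<phi> = "\<lambda>S. transpose_mat M' *\<^sub>v S"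
  have t: "transpose_mat M * transpose_mat M' = 1\<^sub>m n"
    using M M' by (metis transpose_mult transpose_one)
  have inv: "transpose_mat M *\<^sub>v ?\<phi> S = S" if "S \<in> V n" for S
    using that M M' t
    by (subst assoc_mult_mat_vec[symmetric, of _ n n _ n]) auto
  have "additive_on n ?\<phi>"
    using M' by (auto simp: additive_on_def mult_add_distrib_mat_vec[of _ n n])
  moreover have "x = 0\<^sub>v n" if "x \<in> V n" "?\<phi> x = 0\<^sub>v n" for x
    using inv[OF that(1)] that(2) M by (auto intro!: eq_vecI simp: scalar_prod_def)
  ultimately have "lin_bij n ?\<phi>" by (rule lin_bijI)
  then show ?thesis using inv by blast
qed

text \<open>The matrix is the transpose of that of the inverse of \<open>\<phi>\<close>. A search
  over linear bijections of the characters is therefore a search over \<open>GL n\<close>.\<close>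

lemma GL_of_lin_bij:
  assumes "lin_bij n \<phi>"
  shows "\<exists>M\<in>GL n. \<forall>S\<in>V n. transpose_mat M *\<^sub>v \<phi> S = S"
proof -
  note \<phi> = lin_bijD[OF assms]
  define \<psi> where "\<psi> = inv_into (V n) \<phi>"
  have \<psi>: "\<psi> x \<in> V n" "\<phi> (\<psi> x) = x" "\<psi> (\<phi> x) = x" if "x \<in> V n" for x
    using that \<phi>(3) unfolding \<psi>_def
    by (auto simp: bij_betw_inv_into_left bij_betw_inv_into_right bij_betw_def inv_into_into)
  have "additive_on n \<psi>"
    unfolding additive_on_def
  proof (intro conjI ballI)
    fix x y assume xy: "x \<in> V n" "y \<in> V n"
    have "\<psi> (x + y) = \<psi> (\<phi> (\<psi> x + \<psi> y))"
      using xy \<psi> \<phi> by simp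
    also have "\<dots> = \<psi> x + \<psi> y"
      using xy \<psi> by simp
    finally show "\<psi> (x + y) = \<psi> x + \<psi> y" .
  qed (use \<psi> in auto)
  then obtain N' where N': "N' \<in> carrier_mat n n" "\<And>x. x \<in> V n \<Longrightarrow> N' *\<^sub>v x = \<psi> x"
    using additive_matrix by blast
  obtain N where N: "N \<in> carrier_mat n n" "\<And>x. x \<in> V n \<Longrightarrow> N *\<^sub>v x = \<phi> x"
    using additive_matrix[of n \<phi>] assms by (auto simp: lin_bij_def)
  have "N * N' = 1\<^sub>m n" "N' * N = 1\<^sub>m n"
    using N N' \<psi> \<phi> by (auto intro!: mat_eq_by_vec[of _ n])
  then have "transpose_mat N' * transpose_mat N = 1\<^sub>m n" "transpose_mat N * transpose_mat N' = 1\<^sub>m n"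
    using N N' by (metis transpose_mult transpose_one)+
  then have "transpose_mat N' \<in> GL n"
    using N N' by (auto simp: GL_def invertible_mat_def inverts_mat_def intro!: exI[of _ "transpose_mat N"])
  then show ?thesis
    using N'(2) \<phi> \<psi> by (intro bexI[of _ "transpose_mat N'"]) auto
qed

text \<open>The value of \<open>chi S\<close> at \<open>x\<close> is that of
  \<open>chi (\<phi> S)\<close> at \<open>M *\<^sub>v x\<close>, as \<open>S\<close> is the
  transpose of \<open>M\<close> applied to \<open>\<phi> S\<close>. Since \<open>M\<close> permutes
  the space, it then disappears from the averages.\<close>

lemma correlation_GL:
  assumes M: "M \<in> GL n" and \<phi>: "\<And>S. S \<in> V n \<Longrightarrow> \<phi> S \<in> V n \<and> transpose_mat M *\<^sub>v \<phi> S = S"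
  shows "avg (V n) (\<lambda>x. f (M *\<^sub>v x) * p x) = (\<Sum>S\<in>V n. fourier_coeff n p S * fourier_coeff n f (\<phi> S))"
proof -
  have Mc: "M \<in> carrier_mat n n" using M by (simp add: GL_def)
  have "avg (V n) (\<lambda>x. f (M *\<^sub>v x) * p x)
    = avg (V n) (\<lambda>x. \<Sum>S\<in>V n. fourier_coeff n p S * (f (M *\<^sub>v x) * chi (\<phi> S) (M *\<^sub>v x)))"
  proof (intro avg_cong refl)
    fix x assume x: "x \<in> V n"
    have "p x = (\<Sum>S\<in>V n. fourier_coeff n p S * chi (\<phi> S) (M *\<^sub>v x))"
      unfolding fourier_expansion[OF x, of p]
      using \<phi> Mc x by (intro sum.cong refl) (simp add: chi_transpose[of M n n, symmetric])
    then show "f (M *\<^sub>v x) * p x = (\<Sum>S\<in>V n. fourier_coeff n p S * (f (M *\<^sub>v x) * chi (\<phi> S) (M *\<^sub>v x)))"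
      by (simp add: sum_distrib_left mult_ac)
  qed
  also have "\<dots> = (\<Sum>S\<in>V n. fourier_coeff n p S * avg (V n) (\<lambda>x. f (M *\<^sub>v x) * chi (\<phi> S) (M *\<^sub>v x)))"
    by (simp only: avg_sum avg_cmult)
  also have "\<dots> = (\<Sum>S\<in>V n. fourier_coeff n p S * fourier_coeff n f (\<phi> S))"
    unfolding fourier_coeff_avg[of n f]
    by (intro sum.cong refl arg_cong2[where f = "(*)"] avg_reindex[OF GL_bij[OF M], of "\<lambda>y. f y * chi (\<phi> _) y"])
  finally show ?thesis .
qed

subsection \<open>The tester\<close>

text \<open>
  Without the condition on \<open>U\<close>, distinct characters of \<open>P\<close> could be sent to the same heavy
  coefficient of the restriction, which no linear bijection of \<open>F_2^n\<close> achieves.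
\<close>

definition accept :: "nat \<Rightarrow> nat \<Rightarrow> bvec set \<Rightarrow> bvec set \<Rightarrow> (bvec \<Rightarrow> real) \<Rightarrow> real \<Rightarrow> bit mat \<Rightarrow> (bvec \<Rightarrow> real) \<Rightarrow> bool" where
  "accept n k U P c \<tau> B G \<longleftrightarrow> (\<exists>\<phi>. lin_bij n \<phi>
     \<and> (\<forall>s\<in>U. transpose_mat B *\<^sub>v \<phi> s = 0\<^sub>v k \<longrightarrow> s = 0\<^sub>v n)
     \<and> \<tau> \<le> (\<Sum>S\<in>P. c S * G (transpose_mat B *\<^sub>v \<phi> S)))"

lemma weighted_sum_close:
  fixes c h h' :: "'a \<Rightarrow> real"
  assumes "finite A" "P \<subseteq> A" "(\<Sum>S\<in>A. \<bar>c S\<bar>) \<le> T" "\<And>S. S \<in> P \<Longrightarrow> \<bar>h S - h' S\<bar> \<le> \<delta>" "0 \<le> \<delta>"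
  shows "\<bar>(\<Sum>S\<in>P. c S * h S) - (\<Sum>S\<in>P. c S * h' S)\<bar> \<le> T * \<delta>"
proof -
  have "\<bar>(\<Sum>S\<in>P. c S * h S) - (\<Sum>S\<in>P. c S * h' S)\<bar> = \<bar>\<Sum>S\<in>P. c S * (h S - h' S)\<bar>"
    by (simp add: sum_subtractf right_diff_distrib)
  also have "\<dots> \<le> (\<Sum>S\<in>P. \<bar>c S\<bar> * \<delta>)"
    using assms by (intro order_trans[OF sum_abs] sum_mono) (auto simp: abs_mult intro: mult_left_mono)
  also have "\<dots> \<le> (\<Sum>S\<in>A. \<bar>c S\<bar> * \<delta>)"
    using assms by (intro sum_mono2) auto
  also have "\<dots> \<le> T * \<delta>"
    unfolding sum_distrib_right[symmetric] using assms by (intro mult_right_mono)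
  finally show ?thesis .
qed

lemma transpose_add:
  assumes "B \<in> carrier_mat n k" "x \<in> V n" "y \<in> V n"
  shows "transpose_mat B *\<^sub>v (x + y) = transpose_mat B *\<^sub>v x + transpose_mat B *\<^sub>v y"
  using assms by (intro mult_add_distrib_mat_vec[of _ k n]) auto

lemma transpose_eq_iff:
  assumes "B \<in> carrier_mat n k" "x \<in> V n" "y \<in> V n"
  shows "transpose_mat B *\<^sub>v (x + y) = 0\<^sub>v k \<longleftrightarrow> transpose_mat B *\<^sub>v x = transpose_mat B *\<^sub>v y"
  using assms by (simp add: transpose_add add_eq_zero_bvec)

lemma subsp_kernel:
  assumes "B \<in> carrier_mat n k"
  shows "subsp n {x \<in> V n. transpose_mat B *\<^sub>v x = 0\<^sub>v k}"
  using assms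
  by (auto simp: subsp_def transpose_add intro!: eq_vecI)

section \<open>Completeness and soundness of acceptance for one good matrix\<close>

context
  fixes n k :: nat and f :: "bvec \<Rightarrow> real" and B :: "bit mat" and L W :: "bvec set" and \<theta> :: real
    and G :: "bvec \<Rightarrow> real"
  assumes B: "B \<in> carrier_mat n k" and W: "subsp n W" and LW: "L \<subseteq> W"
    and light: "\<And>S. S \<in> V n \<Longrightarrow> S \<notin> L \<Longrightarrow> \<bar>fourier_coeff n f S\<bar> \<le> \<theta>"
    and good: "good_matrix n k f W L \<theta> B"
    and G: "\<And>u. u \<in> V k \<Longrightarrow> \<bar>G u - restricted_coeff k f B u\<bar> \<le> \<theta>"
begin

text \<open>The estimate can go wrong only if \<open>S\<close> collides with a heavy character. Then
  \<open>gen\<close> places \<open>S\<close> in \<open>W\<close>, where the transpose is injective,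
  so \<open>S\<close> is that character. Without a collision both true coefficients are at most
  \<open>\<theta>\<close>, and the sampling error supplies the third
  \<open>\<theta>\<close>.\<close>

lemma estimate_close:
  assumes S: "S \<in> V n" and gen: "\<And>R. R \<in> L \<Longrightarrow> transpose_mat B *\<^sub>v R = transpose_mat B *\<^sub>v S \<Longrightarrow> S \<in> W"
  shows "\<bar>G (transpose_mat B *\<^sub>v S) - fourier_coeff n f S\<bar> \<le> 3 * \<theta>"
proof -
  let ?u = "transpose_mat B *\<^sub>v S"
  note g = good[unfolded good_matrix_def]
  have u: "?u \<in> V k" using B by simp
  have \<theta>: "0 \<le> \<theta>" using G[OF u] by linarith
  show ?thesis
  proof (cases "S \<in> L")
    case True
    then have "\<bar>restricted_coeff k f B ?u - fourier_coeff n f S\<bar> \<le> \<theta>" using g by blast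
    with G[OF u] \<theta> show ?thesis by linarith
  next
    case False
    have "?u \<notin> (\<lambda>S. transpose_mat B *\<^sub>v S) ` L"
    proof
      assume "?u \<in> (\<lambda>S. transpose_mat B *\<^sub>v S) ` L"
      then obtain R where R: "R \<in> L" "transpose_mat B *\<^sub>v R = ?u" by auto
      have "S \<in> W" "R \<in> W" using gen[OF R] R LW by auto
      then have "R + S \<in> W" "R \<in> V n" using subspD[OF W] by auto
      moreover have "transpose_mat B *\<^sub>v (R + S) = 0\<^sub>v k"
        using transpose_eq_iff[OF B \<open>R \<in> V n\<close> S] R by simp
      ultimately have "R + S = 0\<^sub>v n" using g by blast
      then show False using R False \<open>R \<in> V n\<close> S by (simp add: add_eq_zero_bvec)
    qed
    then have "\<bar>restricted_coeff k f B ?u\<bar> \<le> \<theta>" using g u by blast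
    with G[OF u] light[OF S False] show ?thesis by linarith
  qed
qed

text \<open>The given \<open>\<phi>\<close> is itself a witness: \<open>W\<close> contains the image
  of \<open>U\<close>, so nothing in it collapses and the estimates there are accurate.\<close>

lemma accept_complete:
  assumes \<phi>: "lin_bij n \<phi>" and U: "P \<subseteq> U" "U \<subseteq> V n" "\<phi> ` U \<subseteq> W"
    and c: "(\<Sum>S\<in>V n. \<bar>c S\<bar>) \<le> T" and \<tau>: "\<tau> + T * (3 * \<theta>) \<le> (\<Sum>S\<in>P. c S * fourier_coeff n f (\<phi> S))"
  shows "accept n k U P c \<tau> B G"
  unfolding accept_def
proof (intro exI[of _ \<phi>] conjI \<phi> ballI impI)
  note \<phi> = lin_bijD[OF \<phi>]
  fix s assume s: "s \<in> U" "transpose_mat B *\<^sub>v \<phi> s = 0\<^sub>v k"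
  then have "\<phi> s = 0\<^sub>v n" using good U unfolding good_matrix_def by blast
  then show "s = 0\<^sub>v n"
    using \<phi>(4,5) s(1) U(2) inj_onD[of \<phi> "V n" s "0\<^sub>v n"] by auto
next
  have \<theta>: "0 \<le> \<theta>" using G[OF zero_carrier_vec] by linarith
  have "\<bar>(\<Sum>S\<in>P. c S * G (transpose_mat B *\<^sub>v \<phi> S)) - (\<Sum>S\<in>P. c S * fourier_coeff n f (\<phi> S))\<bar> \<le> T * (3 * \<theta>)"
  proof (rule weighted_sum_close[OF finite_V _ c])
    fix S assume "S \<in> P"
    then have "\<phi> S \<in> W" using U by auto
    then show "\<bar>G (transpose_mat B *\<^sub>v \<phi> S) - fourier_coeff n f (\<phi> S)\<bar> \<le> 3 * \<theta>"
      using subspD(4)[OF W] by (intro estimate_close) auto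
  qed (use U \<theta> in auto)
  with \<tau> show "\<tau> \<le> (\<Sum>S\<in>P. c S * G (transpose_mat B *\<^sub>v \<phi> S))" by linarith
qed

text \<open>Goodness makes \<open>W\<close>, and acceptance makes the image of \<open>U\<close>,
  meet the kernel \<open>K\<close> trivially. So some bijection \<open>\<sigma>\<close> moves
  vectors only within their cosets of \<open>K\<close> and sends the image of \<open>U\<close> into
  \<open>W\<close> wherever their cosets meet. Composing with \<open>\<sigma>\<close> leaves the
  estimates unchanged and makes them accurate.\<close>

lemma accept_sound:
  assumes U: "subsp n U" "P \<subseteq> U" and c: "(\<Sum>S\<in>V n. \<bar>c S\<bar>) \<le> T" and acc: "accept n k U P c \<tau> B G"
  shows "\<exists>\<phi>. lin_bij n \<phi> \<and> \<tau> - T * (3 * \<theta>) \<le> (\<Sum>S\<in>P. c S * fourier_coeff n f (\<phi> S))"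
proof -
  from acc obtain \<phi> where \<phi>: "lin_bij n \<phi>"
    and ker: "\<And>s. s \<in> U \<Longrightarrow> transpose_mat B *\<^sub>v \<phi> s = 0\<^sub>v k \<Longrightarrow> s = 0\<^sub>v n"
    and le: "\<tau> \<le> (\<Sum>S\<in>P. c S * G (transpose_mat B *\<^sub>v \<phi> S))"
    unfolding accept_def by blast
  define K where "K = {x \<in> V n. transpose_mat B *\<^sub>v x = 0\<^sub>v k}"
  have K: "subsp n K" unfolding K_def by (rule subsp_kernel[OF B])
  have UK: "x = 0\<^sub>v n" if "x \<in> \<phi> ` U" "x \<in> K" for x
  proof -
    obtain s where "s \<in> U" "x = \<phi> s" using \<open>x \<in> \<phi> ` U\<close> by blast
    then show ?thesis using that(2) ker[of s] lin_bijD(5)[OF \<phi>] by (simp add: K_def)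
  qed
  have WK: "x = 0\<^sub>v n" if "x \<in> W" "x \<in> K" for x
    using that good unfolding good_matrix_def K_def by blast
  obtain \<sigma> where \<sigma>: "lin_bij n \<sigma>" "\<And>x. x \<in> V n \<Longrightarrow> \<sigma> x + x \<in> K"
    "\<And>u w. u \<in> \<phi> ` U \<Longrightarrow> w \<in> W \<Longrightarrow> u + w \<in> K \<Longrightarrow> \<sigma> u = w"
    using ex_lin_bij_modulo[OF K subsp_image[OF U(1) \<phi>] UK W WK] by blast
  note p = lin_bijD[OF \<phi>] and s = lin_bijD[OF \<sigma>(1)]
  have \<theta>: "0 \<le> \<theta>" using G[OF zero_carrier_vec] by linarith
  have UV: "S \<in> V n" if "S \<in> P" for S using that U subspD(4)[OF U(1)] by auto
  have "\<bar>(\<Sum>S\<in>P. c S * G (transpose_mat B *\<^sub>v \<phi> S)) - (\<Sum>S\<in>P. c S * fourier_coeff n f (\<sigma> (\<phi> S)))\<bar> \<le> T * (3 * \<theta>)"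
  proof (rule weighted_sum_close[OF finite_V _ c])
    fix S assume S: "S \<in> P"
    have v: "\<phi> S \<in> V n" "\<sigma> (\<phi> S) \<in> V n" using UV[OF S] p s by auto
    have eq: "transpose_mat B *\<^sub>v \<sigma> (\<phi> S) = transpose_mat B *\<^sub>v \<phi> S"
      using \<sigma>(2)[OF v(1)] v by (simp add: K_def transpose_eq_iff[OF B])
    have "\<bar>G (transpose_mat B *\<^sub>v \<sigma> (\<phi> S)) - fourier_coeff n f (\<sigma> (\<phi> S))\<bar> \<le> 3 * \<theta>"
    proof (rule estimate_close[OF v(2)])
      fix R assume R: "R \<in> L" "transpose_mat B *\<^sub>v R = transpose_mat B *\<^sub>v \<sigma> (\<phi> S)"
      then have "R \<in> W" "R \<in> V n" using LW subspD[OF W] by auto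
      \<comment> \<open>A collision with the heavy \<open>R\<close> means that
        \<open>\<phi> S\<close> and \<open>R\<close> agree modulo \<open>K\<close>, and in this case
        \<open>\<sigma>\<close> sends \<open>\<phi> S\<close> to \<open>R\<close>.\<close>
      moreover have "\<phi> S + R \<in> K"
        using R eq v \<open>R \<in> V n\<close> by (simp add: K_def transpose_eq_iff[OF B])
      ultimately have "\<sigma> (\<phi> S) = R" using S U by (intro \<sigma>(3)) auto
      then show "\<sigma> (\<phi> S) \<in> W" using \<open>R \<in> W\<close> by simp
    qed
    then show "\<bar>G (transpose_mat B *\<^sub>v \<phi> S) - fourier_coeff n f (\<sigma> (\<phi> S))\<bar> \<le> 3 * \<theta>"
      by (simp only: eq)
  qed (use UV \<theta> in auto)
  then have "\<tau> - T * (3 * \<theta>) \<le> (\<Sum>S\<in>P. c S * fourier_coeff n f (\<sigma> (\<phi> S)))"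
    using le by linarith
  then show ?thesis using lin_bij_comp[OF \<phi> \<sigma>(1)] by blast
qed

end

section \<open>Nonadaptive decision trees\<close>

primrec query_all :: "bvec list \<Rightarrow> (real list \<Rightarrow> bool) \<Rightarrow> decision_tree" where
  "query_all [] D = Answer (D [])"
| "query_all (z # zs) D =
     Query z (query_all zs (\<lambda>ys. D (- 1 # ys))) (query_all zs (\<lambda>ys. D (1 # ys)))"

text \<open>The tree records every answer other than \<open>- 1\<close> as \<open>1\<close>, so its
  record is \<open>map f zs\<close> when the values of \<open>f\<close> are signs.\<close>

lemma outcome_query_all:
  "(\<And>z. z \<in> set zs \<Longrightarrow> f z \<in> {- 1, 1}) \<Longrightarrow> outcome (query_all zs D) f = D (map f zs)"
proof (induction zs arbitrary: D)
  case (Cons z zs)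
  have IH: "outcome (query_all zs D) f = D (map f zs)" for D
    using Cons by simp
  have "f z = - 1 \<or> f z = 1" using Cons.prems[of z] by simp
  then show ?case by (elim disjE) (simp_all add: IH)
qed simp

lemma num_queries_query_all: "num_queries (query_all zs D) f = length zs"
  by (induction zs arbitrary: D) auto

lemma query_points_query_all: "query_points (query_all zs D) \<subseteq> set zs"
  by (induction zs arbitrary: D) auto

section \<open>Distance, correlation and truncation of the spectrum\<close>

lemma prob_pmf_of_set_avg:
  assumes "finite A" "A \<noteq> {}"
  shows "measure_pmf.prob (pmf_of_set A) {x. Q x} = avg A (\<lambda>x. of_bool (Q x))"
  using assms by (simp add: measure_pmf_of_set avg_def)

lemma rel_dist_correlation:
  assumes f: "f \<in> V n \<rightarrow> {- 1, 1}" and g: "g \<in> V n \<rightarrow> {- 1, 1}"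
  shows "avg (V n) (\<lambda>x. f x * g x) = 1 - 2 * rel_dist n f g"
proof -
  have "avg (V n) (\<lambda>x. f x * g x) = avg (V n) (\<lambda>x. 1 - 2 * of_bool (f x \<noteq> g x))"
  proof (intro avg_cong refl)
    fix x assume "x \<in> V n"
    then have "f x \<in> {- 1, 1}" "g x \<in> {- 1, 1}" using f g by auto
    then show "f x * g x = 1 - 2 * of_bool (f x \<noteq> g x)" by auto
  qed
  then show ?thesis
    by (simp add: avg_diff avg_cmult avg_const_V rel_dist_def prob_pmf_of_set_avg[OF finite_V V_nonempty])
qed

text \<open>The sum is the correlation of \<open>f\<close> composed with \<open>M\<close> and
  \<open>p\<close>. Replacing \<open>p\<close> by \<open>g\<close> costs at most
  \<open>\<alpha>\<close>, and for signs the correlation determines the distance.\<close>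

lemma correlation_lin_bij:
  assumes f: "f \<in> V n \<rightarrow> {- 1, 1}" and g: "g \<in> V n \<rightarrow> {- 1, 1}" and p: "approximates n \<alpha> p g"
    and M: "M \<in> GL n" and \<phi>: "lin_bij n \<phi>" "\<And>S. S \<in> V n \<Longrightarrow> transpose_mat M *\<^sub>v \<phi> S = S"
  shows "\<bar>(\<Sum>S\<in>V n. fourier_coeff n p S * fourier_coeff n f (\<phi> S))
    - (1 - 2 * rel_dist n (\<lambda>x. f (M *\<^sub>v x)) g)\<bar> \<le> \<alpha>"
proof -
  have Mc: "M \<in> carrier_mat n n" using M by (simp add: GL_def)
  have fM: "(\<lambda>x. f (M *\<^sub>v x)) \<in> V n \<rightarrow> {- 1, 1}"
    using f Mc by (auto intro: PiE mult_mat_vec_carrier)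
  have "(\<Sum>S\<in>V n. fourier_coeff n p S * fourier_coeff n f (\<phi> S)) = avg (V n) (\<lambda>x. f (M *\<^sub>v x) * p x)"
    using \<phi> lin_bijD(1)[OF \<phi>(1)] by (intro correlation_GL[OF M, symmetric]) auto
  then have "(\<Sum>S\<in>V n. fourier_coeff n p S * fourier_coeff n f (\<phi> S))
    - (1 - 2 * rel_dist n (\<lambda>x. f (M *\<^sub>v x)) g) = avg (V n) (\<lambda>x. f (M *\<^sub>v x) * (p x - g x))"
    by (simp only: rel_dist_correlation[OF fM g, symmetric] avg_diff right_diff_distrib)
  also have "\<bar>\<dots>\<bar> \<le> \<alpha>"
    using p sign_abs[OF fM] by (intro abs_avg_le_V) (auto simp: approximates_def abs_mult abs_minus_commute)
  finally show ?thesis .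
qed

text \<open>Cauchy-Schwarz on the discarded characters: their weights are below
  \<open>\<eta>\<close>, so the squares sum to at most \<open>\<eta> * T\<close>, and the squared
  coefficients of \<open>f\<close> sum to at most \<open>1\<close> by Parseval, since
  \<open>\<phi>\<close> only permutes them.\<close>

lemma truncation_error:
  assumes f: "f \<in> V n \<rightarrow> {- 1, 1}" and \<phi>: "lin_bij n \<phi>" and T: "(\<Sum>S\<in>V n. \<bar>c S\<bar>) \<le> T"
    and \<eta>: "0 \<le> \<eta>" "\<eta> * T \<le> \<delta>\<^sup>2" "0 \<le> \<delta>"
  shows "\<bar>(\<Sum>S\<in>V n. c S * fourier_coeff n f (\<phi> S))
    - (\<Sum>S\<in>{S \<in> V n. \<eta> \<le> \<bar>c S\<bar>}. c S * fourier_coeff n f (\<phi> S))\<bar> \<le> \<delta>"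
proof -
  let ?P = "{S \<in> V n. \<eta> \<le> \<bar>c S\<bar>}"
  let ?F = "\<lambda>S. fourier_coeff n f (\<phi> S)"
  have "(\<Sum>S\<in>V n. c S * ?F S) = (\<Sum>S\<in>V n - ?P. c S * ?F S) + (\<Sum>S\<in>?P. c S * ?F S)"
    by (rule sum.subset_diff) (auto simp: finite_V)
  moreover have "(\<Sum>S\<in>V n - ?P. c S * ?F S)\<^sup>2 \<le> \<delta>\<^sup>2"
  proof -
    have "(\<Sum>S\<in>V n - ?P. (c S)\<^sup>2) \<le> (\<Sum>S\<in>V n - ?P. \<eta> * \<bar>c S\<bar>)"
    proof (rule sum_mono)
      fix S assume "S \<in> V n - ?P"
      then have "\<bar>c S\<bar> * \<bar>c S\<bar> \<le> \<eta> * \<bar>c S\<bar>" by (intro mult_right_mono) auto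
      then show "(c S)\<^sup>2 \<le> \<eta> * \<bar>c S\<bar>" by (simp add: power2_eq_square)
    qed
    also have "\<dots> \<le> (\<Sum>S\<in>V n. \<eta> * \<bar>c S\<bar>)"
      using \<eta> by (intro sum_mono2 finite_V) auto
    also have "\<dots> \<le> \<eta> * T"
      unfolding sum_distrib_left[symmetric] using T \<eta> by (intro mult_left_mono)
    finally have c: "(\<Sum>S\<in>V n - ?P. (c S)\<^sup>2) \<le> \<delta>\<^sup>2" using \<eta> by linarith
    have "(\<Sum>S\<in>V n - ?P. (?F S)\<^sup>2) \<le> (\<Sum>S\<in>V n. (?F S)\<^sup>2)"
      by (intro sum_mono2 finite_V) auto
    also have "\<dots> = 1"
      using sum.reindex_bij_betw[OF lin_bijD(3)[OF \<phi>], of "\<lambda>S. (fourier_coeff n f S)\<^sup>2"] parseval_sign[OF f]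
      by simp
    finally have F: "(\<Sum>S\<in>V n - ?P. (?F S)\<^sup>2) \<le> 1" .
    have "(\<Sum>S\<in>V n - ?P. c S * ?F S)\<^sup>2 \<le> (\<Sum>S\<in>V n - ?P. (c S)\<^sup>2) * (\<Sum>S\<in>V n - ?P. (?F S)\<^sup>2)"
      by (rule Cauchy_Schwarz_ineq_sum)
    also have "\<dots> \<le> \<delta>\<^sup>2 * 1"
      by (intro mult_mono c F sum_nonneg) auto
    finally show ?thesis by simp
  qed
  then have "\<bar>\<Sum>S\<in>V n - ?P. c S * ?F S\<bar>\<^sup>2 \<le> \<delta>\<^sup>2"
    by (simp only: power2_abs)
  then have "\<bar>\<Sum>S\<in>V n - ?P. c S * ?F S\<bar> \<le> \<delta>"
    using \<eta>(3) by (rule power2_le_imp_le)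
  ultimately show ?thesis by linarith
qed

subsection \<open>Parameters and correctness\<close>

text \<open>By the choice of \<open>k\<close>, \<open>2 ^ k = 4096 * 16 ^ N\<close>, while each
  numerator is at most a constant times \<open>16 ^ N\<close>: the inverse powers of
  \<open>\<theta>\<close> are at most \<open>N\<close>, and \<open>N * N \<le> 4 ^ N\<close>. The
  constants add up to \<open>14 + 56 + 84 = 154\<close>, and the light coefficients contribute
  \<open>1 / 25\<close>.\<close>

lemma failure_probability_matrix:
  fixes r \<theta> \<rho> :: real and N cW cL :: nat
  assumes r: "2 \<le> r" and N: "32400 * r ^ 4 \<le> real N" and \<theta>: "\<theta> = 1 / (6 * r)" and \<rho>: "\<rho> = \<theta>\<^sup>2 / 5"
    and k: "k = 4 * N + 12" and cW: "real cW \<le> 4 ^ N" and cL: "cL \<le> N"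
  shows "real cW * (14 / 2 ^ k) + real cL * (56 / 2 ^ k) / \<theta>\<^sup>2
    + (\<rho>\<^sup>2 + (14 + 56 * real cL + 14 * real cL * real cW) / 2 ^ k) / \<theta> ^ 4 \<le> 1 / 6"
proof -
  define Q :: real where "Q = 16 ^ N"
  have pow: "(2 :: real) ^ k = 4096 * Q"
    unfolding k Q_def by (simp add: power_add power_mult)
  have Q4: "(4 :: real) ^ N * 4 ^ N = Q"
    unfolding Q_def by (simp add: power_mult_distrib[symmetric])
  have N2: "real N \<le> 2 ^ N"
    by (metis less_imp_le of_nat_less_two_power)
  have N4: "real N * real N \<le> 4 ^ N"
    using mult_mono[OF N2 N2] by (simp add: power_mult_distrib[symmetric])
  have one4: "(1 :: real) \<le> 4 ^ N" by simp
  have "4 ^ N * 1 \<le> (4 :: real) ^ N * 4 ^ N" by (intro mult_left_mono) auto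
  then have Q4': "(4 :: real) ^ N \<le> Q" unfolding Q4 by simp
  have r4: "1 \<le> r ^ 4" using r by simp
  have r24: "r\<^sup>2 \<le> r ^ 4" using r by (intro power_increasing) auto
  have \<theta>2: "inverse (\<theta>\<^sup>2) = 36 * r\<^sup>2" and \<theta>4: "inverse (\<theta> ^ 4) = 1296 * r ^ 4"
    using r by (auto simp: \<theta> power_divide power_mult_distrib)
  have i2: "inverse (\<theta>\<^sup>2) \<le> real N" and i4: "inverse (\<theta> ^ 4) \<le> real N"
    unfolding \<theta>2 \<theta>4 using N r24 r4 by linarith+
  have i: "0 \<le> inverse (\<theta>\<^sup>2)" "0 \<le> inverse (\<theta> ^ 4)" by auto
  have N1: "1 \<le> real N" using N r4 by linarith
  have cL': "real cL \<le> real N" using cL by simp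
  have a: "14 * real cW \<le> 14 * Q" using cW Q4' by linarith
  have "real cL * inverse (\<theta>\<^sup>2) \<le> real N * real N"
    using cL' i2 i by (intro mult_mono) auto
  then have b: "56 * (real cL * inverse (\<theta>\<^sup>2)) \<le> 56 * Q" using N4 Q4' by linarith
  have LW: "real cL * real cW \<le> real N * 4 ^ N"
    using cL' cW by (intro mult_mono) auto
  have "1 * 1 \<le> real N * 4 ^ N" "real N * 1 \<le> real N * 4 ^ N"
    using N1 by (intro mult_mono; simp)+
  then have "14 + 56 * real cL + 14 * real cL * real cW \<le> 84 * (real N * 4 ^ N)"
    using LW cL' by simp
  then have "(14 + 56 * real cL + 14 * real cL * real cW) * inverse (\<theta> ^ 4) \<le> 84 * (real N * 4 ^ N) * real N"
    using i4 i N1 by (intro mult_mono) auto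
  also have "\<dots> = 84 * (real N * real N * 4 ^ N)" by simp
  also have "\<dots> \<le> 84 * (4 ^ N * 4 ^ N)"
    using N4 by (intro mult_left_mono mult_right_mono) auto
  finally have c: "(14 + 56 * real cL + 14 * real cL * real cW) * inverse (\<theta> ^ 4) \<le> 84 * Q"
    by (simp only: Q4)
  have d: "\<rho>\<^sup>2 / \<theta> ^ 4 = 1 / 25"
    using r by (simp add: \<rho> \<theta> power_divide power_mult_distrib)
  have "real cW * (14 / 2 ^ k) + real cL * (56 / 2 ^ k) / \<theta>\<^sup>2
      + (\<rho>\<^sup>2 + (14 + 56 * real cL + 14 * real cL * real cW) / 2 ^ k) / \<theta> ^ 4
    = \<rho>\<^sup>2 / \<theta> ^ 4 + (14 * real cW + 56 * (real cL * inverse (\<theta>\<^sup>2))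
        + (14 + 56 * real cL + 14 * real cL * real cW) * inverse (\<theta> ^ 4)) / 2 ^ k"
    unfolding divide_inverse by (simp only: distrib_right distrib_left mult_ac add_ac)
  also have "\<dots> \<le> 1 / 25 + (14 * Q + 56 * Q + 84 * Q) / 2 ^ k"
    unfolding d by (intro add_left_mono divide_right_mono add_mono a b c) auto
  also have "\<dots> = 1 / 25 + 154 / 4096"
    unfolding pow by (simp add: Q_def)
  also have "\<dots> \<le> 1 / 6" by simp
  finally show ?thesis .
qed

text \<open>As \<open>576 = 16 * 36\<close>, the exponent is at least \<open>k + 4\<close>. Then
  \<open>exp 1 \<ge> 2\<close> cancels \<open>2 ^ k\<close> and leaves
  \<open>2 / 16\<close>.\<close>

lemma failure_probability_sampling:
  fixes r :: real
  assumes r: "0 < r" and m: "576 * r\<^sup>2 * (real k + 4) \<le> real m" and \<theta>: "\<theta> = 1 / (6 * r)"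
  shows "2 ^ k * (2 * exp (- (real m * \<theta>\<^sup>2 / 16))) \<le> 1 / 6"
proof -
  have "real k + 4 = 576 * r\<^sup>2 * (real k + 4) * \<theta>\<^sup>2 / 16"
    using r by (simp add: \<theta> power_divide power_mult_distrib field_simps)
  also have "\<dots> \<le> real m * \<theta>\<^sup>2 / 16"
    using m by (intro divide_right_mono mult_right_mono) auto
  finally have "exp (- (real m * \<theta>\<^sup>2 / 16)) \<le> exp (- (real k + 4))" by simp
  also have "\<dots> = inverse (exp (real (k + 4) * 1))"
    by (simp add: exp_minus[symmetric])
  also have "\<dots> = inverse (exp 1 ^ (k + 4))"
    by (simp only: exp_of_nat_mult)
  also have "\<dots> \<le> inverse (2 ^ (k + 4))"
    using exp_ge_add_one_self[of 1] by (intro le_imp_inverse_le power_mono) auto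
  finally have "2 ^ k * (2 * exp (- (real m * \<theta>\<^sup>2 / 16))) \<le> 2 ^ k * (2 * inverse (2 ^ (k + 4)))"
    by (intro mult_left_mono) auto
  also have "\<dots> = 1 / 8" by (simp add: power_add field_simps)
  finally show ?thesis by simp
qed

lemma real_nat_ceiling_le: "0 \<le> x \<Longrightarrow> real (nat \<lceil>x\<rceil>) \<le> x + 1"
  using of_int_ceiling_le_add_one[of x] by simp

lemma sample_size_bound:
  fixes r :: real
  assumes r: "2 \<le> r" and N: "N = nat \<lceil>32400 * r ^ 4\<rceil>" and k: "k = 4 * N + 12"
    and m: "m = nat \<lceil>576 * r\<^sup>2 * (real k + 4)\<rceil>"
  shows "real m \<le> 100000000 * r ^ 6"
proof -
  have r4: "2 ^ 4 \<le> r ^ 4" using r by (intro power_mono) auto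
  have r6: "1 \<le> r ^ 6" using r by simp
  have "real N \<le> 32400 * r ^ 4 + 1"
    unfolding N using r4 by (intro real_nat_ceiling_le) simp
  \<comment> \<open>The left side is at most \<open>129600 * r ^ 4 + 20\<close>, and
    \<open>r ^ 4 \<ge> 16\<close> absorbs the \<open>20\<close>.\<close>
  then have k4: "real k + 4 \<le> 130000 * r ^ 4"
    using r4 by (simp add: k)
  have "576 * r\<^sup>2 * (real k + 4) \<le> 576 * r\<^sup>2 * (130000 * r ^ 4)"
    by (intro mult_left_mono k4) auto
  also have "\<dots> = 74880000 * r ^ 6"
    by (simp add: power_add[symmetric])
  finally have "576 * r\<^sup>2 * (real k + 4) \<le> 74880000 * r ^ 6" .
  moreover have "0 \<le> 576 * r\<^sup>2 * (real k + 4)" by simp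
  ultimately have "real m \<le> 74880000 * r ^ 6 + 1"
    using real_nat_ceiling_le[of "576 * r\<^sup>2 * (real k + 4)"] unfolding m by linarith
  then show ?thesis using r6 by linarith
qed

lemma card_heavy_le:
  fixes h :: "'a \<Rightarrow> real"
  assumes "finite A" "\<And>x. x \<in> A \<Longrightarrow> 0 \<le> h x" "(\<Sum>x\<in>A. h x) \<le> s" "0 < b"
  shows "real (card {x \<in> A. b \<le> h x}) \<le> s / b"
proof -
  have "real (card {x \<in> A. b \<le> h x}) * b \<le> (\<Sum>x\<in>{x \<in> A. b \<le> h x}. h x)"
    by (rule sum_bounded_below) auto
  also have "\<dots> \<le> (\<Sum>x\<in>A. h x)"
    using assms by (intro sum_mono2) auto
  finally show ?thesis using assms by (simp add: field_simps)
qed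

section \<open>The randomized algorithm and its output probabilities\<close>

definition sample_space :: "nat \<Rightarrow> nat \<Rightarrow> nat \<Rightarrow> (bit mat \<times> (nat \<Rightarrow> bvec)) set" where
  "sample_space n k m = carrier_mat n k \<times> ({..<m} \<rightarrow>\<^sub>E V k)"

text \<open>All randomness is drawn before the first query. The sample points live in dimension
  \<open>k\<close>, and \<open>f\<close> is queried at their images under \<open>B\<close>, which
  reveals the restriction at these points.\<close>

definition tester ::
  "nat \<Rightarrow> nat \<Rightarrow> nat \<Rightarrow> bvec set \<Rightarrow> bvec set \<Rightarrow> (bvec \<Rightarrow> real) \<Rightarrow> real \<Rightarrow> decision_tree pmf" where
  "tester n k m U P c \<tau> = map_pmf (\<lambda>(B, xs). query_all (map (\<lambda>j. B *\<^sub>v xs j) [0..<m])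
     (\<lambda>ys. accept n k U P c \<tau> B (\<lambda>u. (\<Sum>j<m. ys ! j * chi u (xs j)) / real m)))
     (pmf_of_set (sample_space n k m))"

lemma sample_space_finite: "finite (sample_space n k m)" and sample_space_ne: "sample_space n k m \<noteq> {}"
proof -
  show "finite (sample_space n k m)"
    unfolding sample_space_def by (intro finite_cartesian_product finite_carrier_mat_bit finite_PiE finite_V) auto
  show "sample_space n k m \<noteq> {}"
    using carrier_mat_nonempty[of n k] V_nonempty[of k] by (auto simp: sample_space_def PiE_eq_empty_iff)
qed

lemma tester_trees:
  assumes "t \<in> set_pmf (tester n k m U P c \<tau>)"
  obtains B xs D where "B \<in> carrier_mat n k" "xs \<in> {..<m} \<rightarrow>\<^sub>E V k"
    "t = query_all (map (\<lambda>j. B *\<^sub>v xs j) [0..<m]) D"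
proof -
  from assms obtain s where s: "s \<in> sample_space n k m" and t: "t = (case s of (B, xs) \<Rightarrow>
     query_all (map (\<lambda>j. B *\<^sub>v xs j) [0..<m])
       (\<lambda>ys. accept n k U P c \<tau> B (\<lambda>u. (\<Sum>j<m. ys ! j * chi u (xs j)) / real m)))"
    unfolding tester_def by (auto simp only: set_map_pmf set_pmf_of_set[OF sample_space_ne sample_space_finite])
  obtain B xs where "s = (B, xs)" by (cases s)
  then show ?thesis
    using that[of B xs] s t by (simp only: sample_space_def mem_Sigma_iff split_conv)
qed

lemma tester_points:
  assumes "B \<in> carrier_mat n k" "xs \<in> {..<m} \<rightarrow>\<^sub>E V k" "j < m"
  shows "B *\<^sub>v xs j \<in> V n"
proof -
  have "xs j \<in> V k" using assms by auto
  then show ?thesis using assms by simp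
qed

lemma tester_randomized: "randomized_alg n (tester n k m U P c \<tau>)"
  unfolding randomized_alg_def
proof
  fix t assume "t \<in> set_pmf (tester n k m U P c \<tau>)"
  then obtain B xs D where t: "B \<in> carrier_mat n k" "xs \<in> {..<m} \<rightarrow>\<^sub>E V k"
    "t = query_all (map (\<lambda>j. B *\<^sub>v xs j) [0..<m]) D"
    by (rule tester_trees)
  have "query_points t \<subseteq> (\<lambda>j. B *\<^sub>v xs j) ` {..<m}"
    unfolding t(3) by (rule order_trans[OF query_points_query_all]) auto
  also have "\<dots> \<subseteq> V n" using tester_points[OF t(1,2)] by blast
  finally show "query_points t \<subseteq> V n" .
qed

lemma tester_makes_queries:
  assumes "real m \<le> q"
  shows "makes_queries n (tester n k m U P c \<tau>) q"
  unfolding makes_queries_def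
proof (intro ballI)
  fix t f assume "t \<in> set_pmf (tester n k m U P c \<tau>)"
  then obtain B xs D where "t = query_all (map (\<lambda>j. B *\<^sub>v xs j) [0..<m]) D"
    by (rule tester_trees)
  then show "real (num_queries t f) \<le> q" using assms by (simp add: num_queries_query_all)
qed

lemma tester_prob:
  assumes f: "f \<in> V n \<rightarrow> {- 1, 1}"
  shows "prob_output (tester n k m U P c \<tau>) f b = avg (sample_space n k m)
    (\<lambda>(B, xs). of_bool (accept n k U P c \<tau> B (empirical_coeff m (\<lambda>x. f (B *\<^sub>v x)) xs) = b))"
proof -
  let ?t = "\<lambda>(B, xs). query_all (map (\<lambda>j. B *\<^sub>v xs j) [0..<m])
     (\<lambda>ys. accept n k U P c \<tau> B (\<lambda>u. (\<Sum>j<m. ys ! j * chi u (xs j)) / real m))"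
  have "prob_output (tester n k m U P c \<tau>) f b
    = measure_pmf.prob (pmf_of_set (sample_space n k m)) {s. outcome (?t s) f = b}"
    by (simp add: prob_output_def tester_def vimage_def)
  also have "\<dots> = avg (sample_space n k m) (\<lambda>s. of_bool (outcome (?t s) f = b))"
    by (rule prob_pmf_of_set_avg[OF sample_space_finite sample_space_ne])
  also have "\<dots> = avg (sample_space n k m)
    (\<lambda>(B, xs). of_bool (accept n k U P c \<tau> B (empirical_coeff m (\<lambda>x. f (B *\<^sub>v x)) xs) = b))"
  proof (intro avg_cong refl)
    fix s assume "s \<in> sample_space n k m"
    then obtain B xs where s: "s = (B, xs)" and B: "B \<in> carrier_mat n k" "xs \<in> {..<m} \<rightarrow>\<^sub>E V k"
      by (auto simp: sample_space_def)
    let ?zs = "map (\<lambda>j. B *\<^sub>v xs j) [0..<m]"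
    have emp: "(\<lambda>u. (\<Sum>j<m. map f ?zs ! j * chi u (xs j)) / real m) = empirical_coeff m (\<lambda>x. f (B *\<^sub>v x)) xs"
      by (simp add: fun_eq_iff empirical_coeff_def)
    have "f z \<in> {- 1, 1}" if "z \<in> set ?zs" for z
      using that tester_points[OF B] by (intro funcset_mem[OF f]) auto
    then have "outcome (query_all ?zs D) f = D (map f ?zs)" for D
      by (rule outcome_query_all)
    then have "outcome (?t s) f = accept n k U P c \<tau> B (empirical_coeff m (\<lambda>x. f (B *\<^sub>v x)) xs)"
      by (simp only: s split_conv emp)
    then show "of_bool (outcome (?t s) f = b) =
      (case s of (B, xs) \<Rightarrow> of_bool (accept n k U P c \<tau> B (empirical_coeff m (\<lambda>x. f (B *\<^sub>v x)) xs) = b))"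
      by (simp only: s split_conv)
  qed
  finally show ?thesis .
qed

text \<open>A bad matrix and, for each fixed matrix, a bad sample each have probability at most
  \<open>1 / 6\<close>; outside these events \<open>Q\<close> holds. The sets \<open>W\<close> and
  \<open>L\<close> are fixed before \<open>B\<close> is drawn.\<close>

lemma prob_accept_lower:
  fixes Q :: "bit mat \<Rightarrow> (nat \<Rightarrow> bvec) \<Rightarrow> bool"
  assumes f: "f \<in> V n \<rightarrow> {- 1, 1}" and \<theta>: "0 < \<theta>" "\<theta> \<le> 1" and m: "0 < m"
    and Q: "\<And>B xs. B \<in> carrier_mat n k \<Longrightarrow> good_matrix n k f W L \<theta> B \<Longrightarrow>
      (\<And>u. u \<in> V k \<Longrightarrow> \<bar>empirical_coeff m (\<lambda>x. f (B *\<^sub>v x)) xs u - restricted_coeff k f B u\<bar> \<le> \<theta>) \<Longrightarrow> Q B xs"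
    and good: "avg (carrier_mat n k) (\<lambda>B. of_bool (\<not> good_matrix n k f W L \<theta> B)) \<le> 1 / 6"
    and sampling: "2 ^ k * (2 * exp (- (real m * \<theta>\<^sup>2 / 16))) \<le> 1 / 6"
  shows "2 / 3 \<le> avg (sample_space n k m) (\<lambda>(B, xs). of_bool (Q B xs))"
proof -
  let ?X = "{..<m} \<rightarrow>\<^sub>E V k"
  let ?N = "carrier_mat n k :: bit mat set"
  let ?err = "\<lambda>B xs. \<exists>u\<in>V k. \<theta> < \<bar>empirical_coeff m (\<lambda>x. f (B *\<^sub>v x)) xs u - restricted_coeff k f B u\<bar>"
  have X: "finite ?X" "?X \<noteq> {}"
    using V_nonempty[of k] by (auto simp: finite_PiE finite_V PiE_eq_empty_iff)
  have "2 / 3 \<le> avg ?N (\<lambda>B. 1 - of_bool (\<not> good_matrix n k f W L \<theta> B) - 1 / 6)"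
    using good by (simp add: avg_diff avg_const_mat)
  also have "\<dots> \<le> avg ?N (\<lambda>B. avg ?X (\<lambda>xs. 1 - of_bool (\<not> good_matrix n k f W L \<theta> B) - of_bool (?err B xs)))"
  proof (rule avg_mono)
    fix B :: "bit mat" assume B: "B \<in> ?N"
    have "(\<lambda>x. f (B *\<^sub>v x)) \<in> V k \<rightarrow> {- 1, 1}"
      using f B by (auto intro: PiE mult_mat_vec_carrier)
    from prob_sampling_error[OF this \<theta> m] sampling
    have "avg ?X (\<lambda>xs. of_bool (?err B xs)) \<le> 1 / 6" by linarith
    then show "1 - of_bool (\<not> good_matrix n k f W L \<theta> B) - 1 / 6
      \<le> avg ?X (\<lambda>xs. 1 - of_bool (\<not> good_matrix n k f W L \<theta> B) - of_bool (?err B xs))"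
      by (simp only: avg_diff avg_const[OF X])
  qed
  also have "\<dots> \<le> avg ?N (\<lambda>B. avg ?X (\<lambda>xs. of_bool (Q B xs)))"
  proof (intro avg_mono)
    fix B :: "bit mat" and xs assume B: "B \<in> ?N"
    have "Q B xs" if "good_matrix n k f W L \<theta> B" "\<not> ?err B xs"
      using that by (intro Q[OF B]) (auto simp: not_less)
    then show "1 - of_bool (\<not> good_matrix n k f W L \<theta> B) - of_bool (?err B xs) \<le> (of_bool (Q B xs) :: real)"
      by (auto simp: of_bool_def)
  qed
  also have "\<dots> = avg (sample_space n k m) (\<lambda>(B, xs). of_bool (Q B xs))"
    by (simp add: sample_space_def avg_Times)
  finally show ?thesis .
qed

text \<open>The algorithm for one fixed approximant \<open>p\<close>. Its parameters are chosen
  without knowledge of \<open>f\<close>; the sets \<open>L\<close> and \<open>W\<close> enter only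
  the analysis.\<close>

lemma tester_exists:
  fixes \<alpha> \<epsilon> \<omega> T :: real
  assumes \<omega>: "0 < \<omega>" "\<omega> \<le> 1 / 2" and \<alpha>: "\<alpha> \<le> \<omega> / 4" and g: "g \<in> V n \<rightarrow> {- 1, 1}"
    and p: "approximates n \<alpha> p g" and T: "spectral_norm n p \<le> T" "1 \<le> T"
  shows "\<exists>A. randomized_alg n A \<and> makes_queries n A (100000000 * (T / \<omega>) ^ 6) \<and>
    (\<forall>f\<in>V n \<rightarrow> {- 1, 1}.
      (lin_dist n f g \<le> \<epsilon> \<longrightarrow> prob_output A f True \<ge> 2 / 3) \<and>
      (lin_dist n f g \<ge> \<epsilon> + \<omega> \<longrightarrow> prob_output A f False \<ge> 2 / 3))"
proof -
  define r where "r = T / \<omega>"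
  have r: "2 \<le> r" using \<omega> T by (simp add: r_def field_simps)
  \<comment> \<open>The number \<open>32400 * r ^ 4\<close> is \<open>1 / \<rho>\<^sup>2\<close>,
    the Parseval bound on the number of heavy characters of \<open>f\<close>. It also exceeds the
    bound \<open>64 * r\<^sup>2\<close> on \<open>card P\<close>.\<close>
  define N where "N = nat \<lceil>32400 * r ^ 4\<rceil>"
  define k where "k = 4 * N + 12"
  define m where "m = nat \<lceil>576 * r\<^sup>2 * (real k + 4)\<rceil>"
  \<comment> \<open>Chosen so that the estimation error \<open>T * (3 * \<theta>)\<close> equals
    \<open>\<omega> / 2\<close>.\<close>
  define \<theta> where "\<theta> = 1 / (6 * r)"
  define \<rho> where "\<rho> = \<theta>\<^sup>2 / 5"
  define c where "c = fourier_coeff n p"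
  \<comment> \<open>Chosen so that \<open>\<eta> * T = (\<omega> / 8)\<^sup>2\<close>, which makes
    the truncation error at most \<open>\<omega> / 8\<close>.\<close>
  define \<eta> where "\<eta> = \<omega>\<^sup>2 / (64 * T)"
  define P where "P = {S \<in> V n. \<eta> \<le> \<bar>c S\<bar>}"
  \<comment> \<open>Midway between the correlations \<open>1 - 2 * \<epsilon>\<close> and
    \<open>1 - 2 * (\<epsilon> + \<omega>)\<close>. The errors \<open>\<omega> / 4\<close>,
    \<open>\<omega> / 8\<close> and \<open>\<omega> / 2\<close> of approximation, truncation and
    estimation stay below the distance \<open>\<omega>\<close> to either side.\<close>
  define \<tau> where "\<tau> = 1 - 2 * \<epsilon> - \<omega>"
  have N: "32400 * r ^ 4 \<le> real N" unfolding N_def by (rule real_nat_ceiling_ge)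
  have m: "576 * r\<^sup>2 * (real k + 4) \<le> real m" unfolding m_def by (rule real_nat_ceiling_ge)
  have "0 < 576 * r\<^sup>2 * (real k + 4)" using r by (intro mult_pos_pos) auto
  then have m0: "0 < m" using m by linarith
  have \<theta>: "0 < \<theta>" "\<theta> \<le> 1" using r by (auto simp: \<theta>_def)
  have "\<theta> * \<theta> \<le> \<theta> * 1" using \<theta> by (intro mult_left_mono) auto
  then have \<rho>: "0 < \<rho>" "\<rho> \<le> \<theta>" using \<theta> by (auto simp: \<rho>_def power2_eq_square)
  have T\<theta>: "T * (3 * \<theta>) = \<omega> / 2" using \<omega> T by (simp add: \<theta>_def r_def)
  have cT: "(\<Sum>S\<in>V n. \<bar>c S\<bar>) \<le> T" using T by (simp add: c_def spectral_norm_def)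
  have \<eta>: "0 < \<eta>" "\<eta> * T \<le> (\<omega> / 8)\<^sup>2" using \<omega> T by (auto simp: \<eta>_def power_divide)
  have PV: "P \<subseteq> V n" "finite P" using finite_V[of n] by (auto simp: P_def)
  have "real (card P) \<le> T / \<eta>"
    unfolding P_def using cT \<eta> by (intro card_heavy_le finite_V) auto
  also have "\<dots> = 64 * r\<^sup>2"
    using \<omega> T by (simp add: \<eta>_def r_def power2_eq_square field_simps)
  also have "\<dots> \<le> real N"
  proof -
    have "r\<^sup>2 \<le> r ^ 4" using r by (intro power_increasing) auto
    moreover have "0 \<le> r ^ 4" by simp
    ultimately show ?thesis using N by linarith
  qed
  finally have cP: "card P \<le> N" by simp
  have "subsp n {0\<^sub>v n}" by (auto simp: subsp_def)
  then obtain U where U: "subsp n U" "P \<subseteq> U" "card U \<le> card {0\<^sub>v n :: bvec} * 2 ^ card P"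
    using ex_small_subsp PV by meson
  have cU: "card U \<le> 2 ^ N"
  proof -
    have "(2 :: nat) ^ card P \<le> 2 ^ N" by (intro power_increasing cP) simp
    moreover have "card U \<le> 2 ^ card P" using U(3) by simp
    ultimately show ?thesis by (rule le_trans[rotated])
  qed
  note UV = subspD(1)[OF U(1)]
  define A where "A = tester n k m U P c \<tau>"
  have "real m \<le> 100000000 * r ^ 6"
    by (rule sample_size_bound[OF r N_def k_def m_def])
  then have queries: "makes_queries n A (100000000 * (T / \<omega>) ^ 6)"
    unfolding A_def r_def by (rule tester_makes_queries)
  have sampling: "2 ^ k * (2 * exp (- (real m * \<theta>\<^sup>2 / 16))) \<le> 1 / 6"
    using r by (intro failure_probability_sampling[OF _ m \<theta>_def]) simp
  have correct: "(lin_dist n f g \<le> \<epsilon> \<longrightarrow> prob_output A f True \<ge> 2 / 3) \<and>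
      (lin_dist n f g \<ge> \<epsilon> + \<omega> \<longrightarrow> prob_output A f False \<ge> 2 / 3)"
    if f: "f \<in> V n \<rightarrow> {- 1, 1}" for f
  proof -
    \<comment> \<open>Squares are compared so that Parseval bounds the number of members
      directly.\<close>
    define L where "L = {S \<in> V n. \<rho>\<^sup>2 \<le> (fourier_coeff n f S)\<^sup>2}"
    have LV: "L \<subseteq> V n" "finite L" using finite_V[of n] by (auto simp: L_def)
    have light: "\<bar>fourier_coeff n f S\<bar> \<le> \<rho>" if "S \<in> V n" "S \<notin> L" for S
    proof (rule power2_le_imp_le)
      show "\<bar>fourier_coeff n f S\<bar>\<^sup>2 \<le> \<rho>\<^sup>2" using that by (simp add: L_def)
    qed (use \<rho> in simp)
    then have light': "\<bar>fourier_coeff n f S\<bar> \<le> \<theta>" if "S \<in> V n" "S \<notin> L" for S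
      using that \<rho> by force
    have "real (card L) \<le> 1 / \<rho>\<^sup>2"
      unfolding L_def using \<rho> by (intro card_heavy_le finite_V) (simp_all add: parseval_sign[OF f])
    also have "\<dots> = 32400 * r ^ 4"
      using r by (simp add: \<rho>_def \<theta>_def power_divide power_mult_distrib)
    also note N
    finally have cL: "card L \<le> N" by simp
    \<comment> \<open>Two subspaces are served: the image of \<open>U\<close> under the bijection of
      a nearby matrix, and zero. Each has at most \<open>2 ^ N\<close> elements, and adjoining
      \<open>L\<close> keeps the size within \<open>4 ^ N\<close>.\<close>
    have ex_W: "\<exists>W. subsp n W \<and> W0 \<subseteq> W \<and> L \<subseteq> W \<and>
      avg (carrier_mat n k) (\<lambda>B. of_bool (\<not> good_matrix n k f W L \<theta> B)) \<le> 1 / 6"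
      if W0: "subsp n W0" "card W0 \<le> 2 ^ N" for W0
    proof -
      obtain W where W: "subsp n W" "W0 \<subseteq> W" "L \<subseteq> W" "card W \<le> card W0 * 2 ^ card L"
        using ex_small_subsp[OF W0(1) LV(2,1)] by blast
      have "card W0 * 2 ^ card L \<le> 2 ^ N * 2 ^ N"
        using W0(2) cL by (intro mult_mono power_increasing) auto
      also have "\<dots> = 4 ^ N" by (simp add: power_mult_distrib[symmetric])
      finally have "card W \<le> 4 ^ N" using W(4) by linarith
      then have "real (card W) \<le> real (4 ^ N)" by (rule of_nat_mono)
      then have cW: "real (card W) \<le> 4 ^ N" by simp
      have "avg (carrier_mat n k) (\<lambda>B. of_bool (\<not> good_matrix n k f W L \<theta> B))
        \<le> real (card W) * (14 / 2 ^ k) + real (card L) * (56 / 2 ^ k) / \<theta>\<^sup>2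
          + (\<rho>\<^sup>2 + (14 + 56 * real (card L) + 14 * real (card L) * real (card W)) / 2 ^ k) / \<theta> ^ 4"
        using subspD[OF W(1)] W(3) light \<theta>(1) by (intro prob_not_good_matrix[OF f]) auto
      also have "\<dots> \<le> 1 / 6"
        by (rule failure_probability_matrix[OF r N \<theta>_def \<rho>_def k_def cW cL])
      finally show ?thesis using W by blast
    qed
    have trunc: "\<bar>(\<Sum>S\<in>V n. c S * fourier_coeff n f (\<phi> S)) - (\<Sum>S\<in>P. c S * fourier_coeff n f (\<phi> S))\<bar> \<le> \<omega> / 8"
      if "lin_bij n \<phi>" for \<phi>
      unfolding P_def using that cT \<eta> \<omega> by (intro truncation_error[OF f]) auto
    have complete: "prob_output A f True \<ge> 2 / 3" if close: "lin_dist n f g \<le> \<epsilon>"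
    proof -
      have "lin_dist n f g \<in> (\<lambda>M. rel_dist n (\<lambda>x. f (M *\<^sub>v x)) g) ` GL n"
        unfolding lin_dist_def using finite_GL one_in_GL by (intro Min_in) blast+
      then obtain M where M: "M \<in> GL n" "rel_dist n (\<lambda>x. f (M *\<^sub>v x)) g \<le> \<epsilon>"
        using close by auto
      obtain \<phi> where \<phi>: "lin_bij n \<phi>" "\<And>S. S \<in> V n \<Longrightarrow> transpose_mat M *\<^sub>v \<phi> S = S"
        using lin_bij_of_GL[OF M(1)] by blast
      have "\<tau> + T * (3 * \<theta>) \<le> (\<Sum>S\<in>P. c S * fourier_coeff n f (\<phi> S))"
        using correlation_lin_bij[OF f g p M(1) \<phi>] trunc[OF \<phi>(1)] M(2) \<alpha> \<omega>
        unfolding T\<theta> \<tau>_def c_def by linarith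
      note acc = accept_complete[OF _ _ _ light' _ _ \<phi>(1) U(2) UV _ cT this]
      have "finite U" using UV finite_V[of n] finite_subset by blast
      then have "card (\<phi> ` U) \<le> 2 ^ N" using cU card_image_le[of U \<phi>] by linarith
      then obtain W where W: "subsp n W" "\<phi> ` U \<subseteq> W" "L \<subseteq> W"
        "avg (carrier_mat n k) (\<lambda>B. of_bool (\<not> good_matrix n k f W L \<theta> B)) \<le> 1 / 6"
        using ex_W[OF subsp_image[OF U(1) \<phi>(1)]] by blast
      show ?thesis
        unfolding A_def tester_prob[OF f]
        by (rule prob_accept_lower[OF f \<theta> m0 _ W(4) sampling]) (use acc W in simp)
    qed
    have sound: "prob_output A f False \<ge> 2 / 3" if far: "lin_dist n f g \<ge> \<epsilon> + \<omega>"
    proof -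
      have no: "\<not> accept n k U P c \<tau> B G"
        if hyp: "B \<in> carrier_mat n k" "subsp n W" "L \<subseteq> W" "good_matrix n k f W L \<theta> B"
          "\<And>u. u \<in> V k \<Longrightarrow> \<bar>G u - restricted_coeff k f B u\<bar> \<le> \<theta>" for B G W
      proof
        assume "accept n k U P c \<tau> B G"
        from accept_sound[OF hyp(1-3) light' hyp(4,5) U(1,2) cT this]
        obtain \<phi> where \<phi>: "lin_bij n \<phi>" "\<tau> - T * (3 * \<theta>) \<le> (\<Sum>S\<in>P. c S * fourier_coeff n f (\<phi> S))"
          by blast
        obtain M where M: "M \<in> GL n" "\<And>S. S \<in> V n \<Longrightarrow> transpose_mat M *\<^sub>v \<phi> S = S"
          using GL_of_lin_bij[OF \<phi>(1)] by blast
        have "lin_dist n f g \<le> rel_dist n (\<lambda>x. f (M *\<^sub>v x)) g"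
          unfolding lin_dist_def using finite_GL M(1) by (intro Min_le) auto
        then show False
          using correlation_lin_bij[OF f g p M(1) \<phi>(1) M(2)] trunc[OF \<phi>(1)] far \<phi>(2) \<alpha> \<omega>
          unfolding T\<theta> \<tau>_def c_def by linarith
      qed
      \<comment> \<open>An accepted bijection depends on \<open>B\<close> and the sample, so its
        images cannot be put into \<open>W\<close> beforehand; here \<open>W\<close> is built from
        \<open>L\<close> alone.\<close>
      obtain W where W: "subsp n W" "L \<subseteq> W"
        "avg (carrier_mat n k) (\<lambda>B. of_bool (\<not> good_matrix n k f W L \<theta> B)) \<le> 1 / 6"
        using ex_W[OF \<open>subsp n {0\<^sub>v n}\<close>] by auto
      show ?thesis
        unfolding A_def tester_prob[OF f]
        by (rule prob_accept_lower[OF f \<theta> m0 _ W(3) sampling]) (use no W in simp)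
    qed
    show ?thesis using complete sound by blast
  qed
  show ?thesis
    using tester_randomized[of n k m U P c \<tau>] queries correct
    unfolding A_def by (intro exI[of _ "tester n k m U P c \<tau>"]) blast
qed

section \<open>The approximate spectral norm and the query bound\<close>

lemma abs_le_spectral_norm:
  assumes "x \<in> V n"
  shows "\<bar>p x\<bar> \<le> spectral_norm n p"
  unfolding fourier_expansion[OF assms, of p] spectral_norm_def
  by (rule order_trans[OF sum_abs]) (simp add: abs_mult)

text \<open>The spectral norm bounds the value of an approximant at a single point, where it is at
  least \<open>1 - \<alpha>\<close> in absolute value. This keeps \<open>t\<close> away from
  zero.\<close>

lemma approx_spectral_norm_ge:
  assumes "0 \<le> \<alpha>" and g: "g \<in> V n \<rightarrow> {- 1, 1}"
  shows "1 - \<alpha> \<le> approx_spectral_norm n \<alpha> g"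
  unfolding approx_spectral_norm_def
proof (rule cInf_greatest[OF approx_spectral_norm_set(1)[OF assms(1)]])
  fix s assume "s \<in> {spectral_norm n p | p. approximates n \<alpha> p g}"
  then obtain p where p: "s = spectral_norm n p" "approximates n \<alpha> p g" by blast
  have "\<bar>g (0\<^sub>v n) - p (0\<^sub>v n)\<bar> \<le> \<alpha>" "\<bar>g (0\<^sub>v n)\<bar> = 1"
    using p(2) sign_abs[OF g] by (auto simp: approximates_def)
  then show "1 - \<alpha> \<le> s"
    using abs_le_spectral_norm[of "0\<^sub>v n" n p] p(1) by simp
qed

theorem theorem3:
  shows "\<exists>(C :: real) (c :: nat). \<forall>(n :: nat) (\<alpha> :: real) (\<epsilon> :: real) (\<omega> :: real)
           (g :: bvec \<Rightarrow> real) (t :: real).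
    \<alpha> \<in> {0<..1/2} \<and> \<epsilon> \<in> {0<..1/2} \<and> \<omega> \<in> {0<..1/2} \<and> \<alpha> \<le> \<omega> / 4 \<and>
    g \<in> carrier_vec n \<rightarrow> {- 1, 1} \<and> t = approx_spectral_norm n \<alpha> g \<longrightarrow>
    (\<exists>A. randomized_alg n A \<and>
      makes_queries n A
        (C * (t / \<omega>) ^ 24 * polylog c t * polylog c (1 / \<alpha>) * polylog c (ln (1 / \<omega>))) \<and>
      (\<forall>f\<in>carrier_vec n \<rightarrow> {- 1, 1}.
        (lin_dist n f g \<le> \<epsilon> \<longrightarrow> prob_output A f True \<ge> 2 / 3) \<and>
        (lin_dist n f g \<ge> \<epsilon> + \<omega> \<longrightarrow> prob_output A f False \<ge> 2 / 3)))"
\<comment> \<open>The constant is \<open>2 ^ 6 * 100000000\<close>, the factor \<open>2\<close>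
  coming from the choice of \<open>p\<close>; degree \<open>0\<close> makes each polylogarithmic
  factor \<open>1\<close>.\<close>
proof (intro exI[of _ "6400000000 :: real"] exI[of _ "0 :: nat"] allI impI)
  fix n :: nat and \<alpha> \<epsilon> \<omega> :: real and g :: "bvec \<Rightarrow> real" and t :: real
  assume "\<alpha> \<in> {0<..1/2} \<and> \<epsilon> \<in> {0<..1/2} \<and> \<omega> \<in> {0<..1/2} \<and> \<alpha> \<le> \<omega> / 4 \<and>
    g \<in> carrier_vec n \<rightarrow> {- 1, 1} \<and> t = approx_spectral_norm n \<alpha> g"
  then have \<alpha>: "0 \<le> \<alpha>" "\<alpha> \<le> 1 / 2" "\<alpha> \<le> \<omega> / 4" and \<omega>: "0 < \<omega>" "\<omega> \<le> 1 / 2"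
    and g: "g \<in> V n \<rightarrow> {- 1, 1}" and t: "t = approx_spectral_norm n \<alpha> g"
    by auto
  have t2: "1 / 2 \<le> t"
    using approx_spectral_norm_ge[OF \<alpha>(1) g] \<alpha>(2) unfolding t by linarith
  \<comment> \<open>As \<open>t > 0\<close>, the infimum lies strictly below \<open>2 * t\<close>,
    so some approximant has norm below \<open>2 * t\<close> whether or not the infimum is
    attained.\<close>
  then have "Inf {spectral_norm n p | p. approximates n \<alpha> p g} < 2 * t"
    unfolding t approx_spectral_norm_def by linarith
  then obtain p where p: "approximates n \<alpha> p g" "spectral_norm n p < 2 * t"
    using cInf_lessD[OF approx_spectral_norm_set(1)[OF \<alpha>(1)]] by blast
  have "1 \<le> t / \<omega>" using \<omega> t2 by (simp add: field_simps)
  \<comment> \<open>Since \<open>t / \<omega> \<ge> 1\<close>, the sixth power obtained is within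
    the stated power.\<close>
  then have "(t / \<omega>) ^ 6 \<le> (t / \<omega>) ^ 24" by (intro power_increasing) auto
  moreover have "(2 * t / \<omega>) ^ 6 = 64 * (t / \<omega>) ^ 6"
    by (simp add: power_mult_distrib power_divide)
  ultimately have bound: "100000000 * (2 * t / \<omega>) ^ 6
      \<le> 6400000000 * (t / \<omega>) ^ 24 * polylog 0 t * polylog 0 (1 / \<alpha>) * polylog 0 (ln (1 / \<omega>))"
    by (simp add: polylog_def)
  from tester_exists[OF \<omega> \<alpha>(3) g p(1) less_imp_le[OF p(2)], of \<epsilon>] t2
  obtain A where A: "randomized_alg n A" "makes_queries n A (100000000 * (2 * t / \<omega>) ^ 6)"
    "\<forall>f\<in>V n \<rightarrow> {- 1, 1}.
      (lin_dist n f g \<le> \<epsilon> \<longrightarrow> prob_output A f True \<ge> 2 / 3) \<and>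
      (lin_dist n f g \<ge> \<epsilon> + \<omega> \<longrightarrow> prob_output A f False \<ge> 2 / 3)"
    by auto
  have "makes_queries n A
     (6400000000 * (t / \<omega>) ^ 24 * polylog 0 t * polylog 0 (1 / \<alpha>) * polylog 0 (ln (1 / \<omega>)))"
    using A(2) bound unfolding makes_queries_def by (meson order_trans)
  then show "\<exists>A. randomized_alg n A \<and>
      makes_queries n A
        (6400000000 * (t / \<omega>) ^ 24 * polylog 0 t * polylog 0 (1 / \<alpha>) * polylog 0 (ln (1 / \<omega>))) \<and>
      (\<forall>f\<in>carrier_vec n \<rightarrow> {- 1, 1}.
        (lin_dist n f g \<le> \<epsilon> \<longrightarrow> prob_output A f True \<ge> 2 / 3) \<and>
        (lin_dist n f g \<ge> \<epsilon> + \<omega> \<longrightarrow> prob_output A f False \<ge> 2 / 3))"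
    using A(1,3) by blast
qed

end
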